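(* Let $T:\mathbb R\to\mathbb R$ be a surjective Markov map satisfying (A1)-(A4) (see context). Each ergodic component $E\subseteq\mathcal C$ of $T$ equals $M_\alpha$ for some $\alpha\in\aleph_{\mathrm{iso}}$ (hence the common period of all Markov intervals $I_j\subseteq E$ is the period of the class $\mathbb Z_\alpha$). Conversely, if $\alpha\in\aleph_{\mathrm{iso}}$ and $\#\mathbb Z_\alpha<\infty$, then $M_\alpha$ is an ergodic component of $T$ contained in $\mathcal C$. If $\alpha\in\aleph_{\mathrm{iso}}$ and $\#\mathbb Z_\alpha=\infty$, then $M_\alpha$ is either an ergodic component of $T$ contained in $\mathcal C$, or a $T$-invariant subset of $\mathcal I_{\mathcal D}$.
   Context: Conventions: $m$ is Lebesgue measure on $\mathbb R$; $\mathbb N=\{0,1,2,\dots\}$, $\mathbb Z^+=\{1,2,\dots\}$; all equalities and inclusions of Borel sets are modulo $m$-null sets. Setting: $(a_j)_{j\in\mathbb Z}$ are reals with $\lim_{j\to\pm\infty}a_j=\pm\infty$, and $I_j:=[a_j,a_{j+1}]$ are the Markov intervals (regarded as a partition of $\mathbb R$, endpoints being ignored). $T:\mathbb R\to\mathbb R$ is a surjective Markov map (values at the points $a_j$ are irrelevant; surjectivity means that each $I_k$ is contained in $TI_j$ for some $j$), with: (A1) there is $\theta>0$ with $0<a_{j+1}-a_j\le\theta$ for all $j$; (A2) $T|_{(a_j,a_{j+1})}$ has a unique extension $\tau_j:I_j\to J_j$ which is twice differentiable and bijective onto $J_j=\bigsqcup_{k=k_{1j}}^{k_{2j}}I_k$,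 for some integers $k_{1j}\le k_{2j}$; (A3) there is $\lambda>1$ with $|\tau_j'|\ge\lambda$ for all $j$; (A4) there is $\eta>0$ with $|\tau_j''/(\tau_j')^2|\le\eta$ for all $j$. Combinatorics: $I_j$ feeds $I_k$ ($I_k$ is accessible from $I_j$) if $T^nI_j\supseteq I_k$ for some $n\in\mathbb Z^+$. $I_j,I_k$ communicate if $j=k$ or each is accessible from the other; this is an equivalence relation on $\mathbb Z$ whose classes are denoted $\mathbb Z_\alpha$, $\alpha\in\aleph$. Put $M_\alpha:=\bigsqcup_{j\in\mathbb Z_\alpha}I_j$. $I_j$ is inessential if it feeds some $I_k$ which does not feed $I_j$, otherwise essential; these are class properties. An essential class not fed by any state outside it is isolated; $\aleph_{\mathrm{iso}}$ is the set of indices of isolated classes. The period of $I_j$ is the g.c.d. of $\{n\in\mathbb Z^+: T^nI_j\supseteq I_j\}$ ($0$ if empty); it is constant on a communicating class, and is called the period of the class. Conservative/dissipative parts: a Borel set $W$ is wandering if the sets $T^{-n}W$, $n\in\mathbb N$, are pairwise disjoint (mod $m$); $\mathcal D$ is the measurable union of all wandering sets and $\mathcal C:=\mathbb R\setminus\mathcal D$. A set $A$ is $T$-invariant if $T^{-1}A=A$. The invariant hull of $A$ is $\mathcal I(A):=\bigcup_{k\in\mathbb Z^+}\bigcup_{n\in\mathbb N}T^{-k}T^nA$, the smallest $T$-invariant set containing $A$. Put $\mathcal I_{\mathcal C\mathcal D}:=\mathcal I(\mathcal C)\cap\mathcal I(\mathcal D)$ and $\mathcal I_{\mathcal D}:=\mathcal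 I(\mathcal D)\setminus\mathcal I_{\mathcal C\mathcal D}$. An ergodic component of $T$ is a $T$-invariant set $A$ with $m(A)>0$ such that every $T$-invariant subset of $A$ is null or equals $A$ mod $m$. *)

theory Defs
  imports "HOL-Analysis.Analysis"
begin

text \<open>
  Inclusion and equality of subsets of the real line modulo Lebesgue-null sets. The sets need not
  be Borel: forward images under the map are Borel only up to null sets.
\<close>

definition subset_mod_null :: "real set \<Rightarrow> real set \<Rightarrow> bool"  (infix "\<subseteq>\<^sub>L" 50) where
  "A \<subseteq>\<^sub>L B \<longleftrightarrow> (AE x in lborel. x \<in> A \<longrightarrow> x \<in> B)"

definition eq_mod_null :: "real set \<Rightarrow> real set \<Rightarrow> bool"  (infix "=\<^sub>L" 50) where
  "A =\<^sub>L B \<longleftrightarrow> (AE x in lborel. x \<in> A \<longleftrightarrow> x \<in> B)"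

definition markov_interval :: "(int \<Rightarrow> real) \<Rightarrow> int \<Rightarrow> real set" where
  "markov_interval a j = {a j .. a (j + 1)}"

text \<open>
  \<open>\<tau> j\<close> is the extension of the \<open>j\<close>-th branch to the closed interval; it is unique since it is
  continuous. \<open>\<tau>' j\<close> and \<open>\<tau>'' j\<close> are its first and second derivatives, one-sided at the end points.
  The values of \<open>T\<close> at the points \<open>a j\<close> are unconstrained, hence surjectivity is stated modulo
  null sets.
\<close>

locale surjective_markov_map =
  fixes a :: "int \<Rightarrow> real"
    and T :: "real \<Rightarrow> real"
    and \<tau> \<tau>' \<tau>'' :: "int \<Rightarrow> real \<Rightarrow> real"
    and k1 k2 :: "int \<Rightarrow> int"
    and \<theta> \<Lambda> \<eta> :: real
  assumes a_at_top: "filterlim a at_top at_top"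
    and a_at_bot: "filterlim a at_bot at_bot"
    and surjective: "\<And>k. \<exists>j. markov_interval a k \<subseteq>\<^sub>L T ` markov_interval a j"
    and A1: "\<theta> > 0" "\<And>j. 0 < a (j + 1) - a j" "\<And>j. a (j + 1) - a j \<le> \<theta>"
    and A2_extends: "\<And>j x. x \<in> {a j <..< a (j + 1)} \<Longrightarrow> \<tau> j x = T x"
    and A2_deriv: "\<And>j x. x \<in> markov_interval a j \<Longrightarrow>
          (\<tau> j has_real_derivative \<tau>' j x) (at x within markov_interval a j)"
    and A2_deriv2: "\<And>j x. x \<in> markov_interval a j \<Longrightarrow>
          (\<tau>' j has_real_derivative \<tau>'' j x) (at x within markov_interval a j)"
    and A2_le: "\<And>j. k1 j \<le> k2 j"
    and A2_bij: "\<And>j. bij_betw (\<tau> j) (markov_interval a j)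
          (\<Union>k\<in>{k1 j .. k2 j}. markov_interval a k)"
    and A3: "\<Lambda> > 1" "\<And>j x. x \<in> markov_interval a j \<Longrightarrow> \<bar>\<tau>' j x\<bar> \<ge> \<Lambda>"
    and A4: "\<eta> > 0" "\<And>j x. x \<in> markov_interval a j \<Longrightarrow> \<bar>\<tau>'' j x / (\<tau>' j x)\<^sup>2\<bar> \<le> \<eta>"

definition feeds :: "(int \<Rightarrow> real) \<Rightarrow> (real \<Rightarrow> real) \<Rightarrow> int \<Rightarrow> int \<Rightarrow> bool" where
  "feeds a T j k \<longleftrightarrow> (\<exists>n\<ge>1. markov_interval a k \<subseteq>\<^sub>L (T ^^ n) ` markov_interval a j)"

definition communicate :: "(int \<Rightarrow> real) \<Rightarrow> (real \<Rightarrow> real) \<Rightarrow> int \<Rightarrow> int \<Rightarrow> bool" where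
  "communicate a T j k \<longleftrightarrow> j = k \<or> (feeds a T j k \<and> feeds a T k j)"

text \<open>The classes themselves serve as the index set \<open>\<aleph>\<close>.\<close>

definition comm_classes :: "(int \<Rightarrow> real) \<Rightarrow> (real \<Rightarrow> real) \<Rightarrow> int set set" where
  "comm_classes a T = UNIV // {(j, k). communicate a T j k}"

definition class_union :: "(int \<Rightarrow> real) \<Rightarrow> int set \<Rightarrow> real set" where
  "class_union a Z = (\<Union>j\<in>Z. markov_interval a j)"

definition inessential :: "(int \<Rightarrow> real) \<Rightarrow> (real \<Rightarrow> real) \<Rightarrow> int \<Rightarrow> bool" where
  "inessential a T j \<longleftrightarrow> (\<exists>k. feeds a T j k \<and> \<not> feeds a T k j)"

definition isolated_classes :: "(int \<Rightarrow> real) \<Rightarrow> (real \<Rightarrow> real) \<Rightarrow> int set set" where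
  "isolated_classes a T = {Z \<in> comm_classes a T.
     (\<forall>j\<in>Z. \<not> inessential a T j) \<and> (\<forall>i k. i \<notin> Z \<longrightarrow> k \<in> Z \<longrightarrow> \<not> feeds a T i k)}"

definition period :: "(int \<Rightarrow> real) \<Rightarrow> (real \<Rightarrow> real) \<Rightarrow> int \<Rightarrow> nat" where
  "period a T j =
     Gcd {n. n \<ge> 1 \<and> markov_interval a j \<subseteq>\<^sub>L (T ^^ n) ` markov_interval a j}"

definition class_period :: "(int \<Rightarrow> real) \<Rightarrow> (real \<Rightarrow> real) \<Rightarrow> int set \<Rightarrow> nat" where
  "class_period a T Z = (THE p. \<forall>j\<in>Z. period a T j = p)"

definition wandering :: "(real \<Rightarrow> real) \<Rightarrow> real set \<Rightarrow> bool" where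
  "wandering T W \<longleftrightarrow> W \<in> sets borel \<and>
     (\<forall>i j. i \<noteq> j \<longrightarrow> (T ^^ i) -` W \<inter> (T ^^ j) -` W =\<^sub>L {})"

text \<open>
  The measurable union of a family is its least Borel upper bound modulo null sets. It is determined
  only modulo null sets, so the choice operator picks a version.
\<close>

definition is_measurable_union :: "real set set \<Rightarrow> real set \<Rightarrow> bool" where
  "is_measurable_union \<W> U \<longleftrightarrow> U \<in> sets borel \<and> (\<forall>W\<in>\<W>. W \<subseteq>\<^sub>L U) \<and>
     (\<forall>V\<in>sets borel. (\<forall>W\<in>\<W>. W \<subseteq>\<^sub>L V) \<longrightarrow> U \<subseteq>\<^sub>L V)"

definition measurable_union :: "real set set \<Rightarrow> real set" where
  "measurable_union \<W> = (SOME U. is_measurable_union \<W> U)"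

definition dissipative_part :: "(real \<Rightarrow> real) \<Rightarrow> real set" where
  "dissipative_part T = measurable_union {W. wandering T W}"

definition conservative_part :: "(real \<Rightarrow> real) \<Rightarrow> real set" where
  "conservative_part T = UNIV - dissipative_part T"

definition T_invariant :: "(real \<Rightarrow> real) \<Rightarrow> real set \<Rightarrow> bool" where
  "T_invariant T A \<longleftrightarrow> A \<in> sets borel \<and> T -` A =\<^sub>L A"

definition invariant_hull :: "(real \<Rightarrow> real) \<Rightarrow> real set \<Rightarrow> real set" where
  "invariant_hull T A = (\<Union>k\<in>{1..}. \<Union>n. (T ^^ k) -` ((T ^^ n) ` A))"

definition hull_CD :: "(real \<Rightarrow> real) \<Rightarrow> real set" where
  "hull_CD T = invariant_hull T (conservative_part T) \<inter> invariant_hull T (dissipative_part T)"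

definition hull_D :: "(real \<Rightarrow> real) \<Rightarrow> real set" where
  "hull_D T = invariant_hull T (dissipative_part T) - hull_CD T"

definition ergodic_component :: "(real \<Rightarrow> real) \<Rightarrow> real set \<Rightarrow> bool" where
  "ergodic_component T A \<longleftrightarrow> T_invariant T A \<and> emeasure lborel A > 0 \<and>
     (\<forall>B. T_invariant T B \<longrightarrow> B \<subseteq>\<^sub>L A \<longrightarrow> B =\<^sub>L {} \<or> B =\<^sub>L A)"

end

theory Submission
  imports Defs
begin

text \<open>
  By (A3) and (A4), \<open>T^n\<close> maps each cylinder of rank \<open>n\<close> onto a full Markov interval with distortion
  bounded independently of \<open>n\<close>. Let \<open>A\<close> be a forward invariant subset of the conservative part that
  meets \<open>I_j\<close> in positive measure. Almost every point of \<open>A \<inter> I_j\<close> returns to \<open>I_j\<close> infinitely often,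
  hence lies in arbitrarily small cylinders that are mapped onto \<open>I_j\<close>; if \<open>I_j - A\<close> had positive
  measure, each of them would miss \<open>A\<close> by a fixed proportion, which is impossible for a disjoint
  cover of \<open>A \<inter> I_j\<close> of nearly the same measure. So \<open>I_j \<subseteq> A\<close>, and \<open>A\<close> contains every interval that
  \<open>I_j\<close> feeds. Applied to invariant sets this gives ergodicity, and applied to the conservative part
  itself it shows that an isolated class is either conservative or dissipative. On a finite isolated
  class, the preimages of a wandering set of positive measure would have measure bounded away from
  \<open>0\<close>, although they are disjoint subsets of a set of finite measure.
\<close>

section \<open>Inclusion modulo null sets\<close>

text \<open>Two obstacles shape the proof. First, inclusions hold only modulo null sets and
  \<open>T\<close> is arbitrary at the end points. The combinatorics is therefore done on
  \<open>generic\<close> points, whose orbits avoid the end points and which leave out only a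
  countable set; as images and preimages of null sets are null, the covering of one interval by the
  image of another becomes membership in a power of the relation \<open>edge\<close>. Second, the
  Markov intervals are bounded in length from above but not from below, so bounded distortion alone
  gives no uniform lower bound for the part of a cylinder that a set misses. Returning to one and
  the same interval does: the missed proportion then depends on that interval only. Likewise a
  finite class has finite measure and only finitely many constants to control. The filling argument
  asks for forward invariance only, since the preimage of the conservative part may be larger than
  that part. In place of the Lebesgue density theorem it uses outer regularity and cylinders stopped
  at their first good rank.\<close>

lemma negligible_iff_AE_lborel: "negligible S \<longleftrightarrow> (AE x in lborel. x \<notin> S)"
proof -
  have "negligible S \<longleftrightarrow> (AE x in lebesgue. x \<notin> S)"
  proof
    assume "negligible S"
    then show "AE x in lebesgue. x \<notin> S"
      by (simp add: negligible_iff_null_sets AE_not_in)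
  next
    assume "AE x in lebesgue. x \<notin> S"
    then obtain N where "N \<in> null_sets lebesgue" "{x. \<not> x \<notin> S} \<subseteq> N"
      by (auto simp: eventually_ae_filter)
    then show "negligible S"
      by (auto simp flip: negligible_iff_null_sets intro: negligible_subset)
  qed
  then show ?thesis
    by (simp add: AE_completion_iff)
qed

lemma countable_imp_negligible: "countable (S :: real set) \<Longrightarrow> negligible S"
  by (simp add: negligible_iff_null_sets countable_imp_null_set_lborel null_sets_completionI)

text \<open>\<open>negligible\<close> makes sense for arbitrary sets and comes with rules for
  Lipschitz and differentiable images, so null set arguments are carried out there.\<close>

lemma subset_mod_null_iff: "A \<subseteq>\<^sub>L B \<longleftrightarrow> negligible (A - B)"
  by (simp add: subset_mod_null_def negligible_iff_AE_lborel)

lemma eq_mod_null_iff: "A =\<^sub>L B \<longleftrightarrow> A \<subseteq>\<^sub>L B \<and> B \<subseteq>\<^sub>L A"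
  unfolding subset_mod_null_def eq_mod_null_def
  by (auto elim: eventually_elim2)

lemma subset_mod_null_trans [trans]: "A \<subseteq>\<^sub>L B \<Longrightarrow> B \<subseteq>\<^sub>L C \<Longrightarrow> A \<subseteq>\<^sub>L C"
  unfolding subset_mod_null_def by (auto elim: eventually_elim2)

lemma subset_imp_subset_mod_null: "A \<subseteq> B \<Longrightarrow> A \<subseteq>\<^sub>L B"
  unfolding subset_mod_null_def by auto

lemma eq_mod_null_empty_iff: "A =\<^sub>L {} \<longleftrightarrow> negligible A"
  by (simp add: eq_mod_null_def negligible_iff_AE_lborel)

lemma subset_mod_null_UN:
  assumes "countable K" "\<And>k. k \<in> K \<Longrightarrow> A k \<subseteq>\<^sub>L B"
  shows "(\<Union>k\<in>K. A k) \<subseteq>\<^sub>L B"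
proof -
  have "negligible (\<Union>k\<in>K. A k - B)"
    using assms by (intro negligible_countable_Union) (auto simp: subset_mod_null_iff)
  then show ?thesis
    by (simp add: subset_mod_null_iff)
qed

section \<open>Measures of images and of countable disjoint unions\<close>

text \<open>By the change of variables formula, the measure of the image is the integral of
  \<open>\<bar>g'\<bar>\<close> over \<open>X\<close>. In the applications \<open>X\<close> is no
  interval but a set of generic points in a cylinder.\<close>

lemma measure_image_bounds:
  fixes g g' :: "real \<Rightarrow> real"
  assumes X: "X \<in> lmeasurable" and gX: "g ` X \<in> lmeasurable" and inj: "inj_on g X"
    and deriv: "\<And>x. x \<in> X \<Longrightarrow> (g has_real_derivative g' x) (at x within X)"
    and bounds: "\<And>x. x \<in> X \<Longrightarrow> c \<le> \<bar>g' x\<bar>" "\<And>x. x \<in> X \<Longrightarrow> \<bar>g' x\<bar> \<le> d"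
  shows "c * measure lebesgue X \<le> measure lebesgue (g ` X)"
    and "measure lebesgue (g ` X) \<le> d * measure lebesgue X"
proof -
  have "(\<lambda>_. 1::real) absolutely_integrable_on g ` X"
    using gX by (simp add: absolutely_integrable_on_const)
  then have abs: "(\<lambda>x. \<bar>g' x\<bar>) absolutely_integrable_on X"
    and eq: "integral X (\<lambda>x. \<bar>g' x\<bar>) = integral (g ` X) (\<lambda>_. 1::real)"
    using has_absolute_integral_change_of_variables_1'[OF fmeasurableD[OF X] deriv inj,
        of "\<lambda>_. 1" "integral (g ` X) (\<lambda>_. 1)"]
    by auto
  have int: "(\<lambda>x. \<bar>g' x\<bar>) integrable_on X"
    using abs by (simp add: set_lebesgue_integral_eq_integral(1))
  have const: "(\<lambda>_. r) integrable_on X" "integral X (\<lambda>_. r) = r * measure lebesgue X" for r :: real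
    using X integral_mult_right[of X r "\<lambda>_. 1::real"]
    by (auto simp: lmeasure_integral integrable_on_const)
  have m: "measure lebesgue (g ` X) = integral X (\<lambda>x. \<bar>g' x\<bar>)"
    using eq gX by (simp add: lmeasure_integral)
  show "c * measure lebesgue X \<le> measure lebesgue (g ` X)"
    unfolding m const(2)[symmetric] using bounds(1) by (intro integral_le const int)
  show "measure lebesgue (g ` X) \<le> d * measure lebesgue X"
    unfolding m const(2)[symmetric] using bounds(2) by (intro integral_le const int)
qed

text \<open>Summation takes place in \<open>ennreal\<close>, where countable additivity needs no
  summability; the bound itself then shows that the union of the \<open>X i\<close> has finite
  measure.\<close>

lemma measure_UN_le_mult:
  fixes c :: real
  assumes I: "countable I" and disj: "disjoint_family_on X I" "disjoint_family_on Y I"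
    and meas: "\<And>i. i \<in> I \<Longrightarrow> X i \<in> lmeasurable" "\<And>i. i \<in> I \<Longrightarrow> Y i \<in> lmeasurable"
    and le: "\<And>i. i \<in> I \<Longrightarrow> measure lebesgue (X i) \<le> c * measure lebesgue (Y i)"
    and c: "c \<ge> 0" and fin: "(\<Union>i\<in>I. Y i) \<in> lmeasurable"
  shows "measure lebesgue (\<Union>i\<in>I. X i) \<le> c * measure lebesgue (\<Union>i\<in>I. Y i)"
proof -
  have "emeasure lebesgue (\<Union>i\<in>I. X i) = (\<integral>\<^sup>+i. emeasure lebesgue (X i) \<partial>count_space I)"
    using meas by (intro emeasure_UN_countable I disj) auto
  also have "\<dots> \<le> (\<integral>\<^sup>+i. ennreal c * emeasure lebesgue (Y i) \<partial>count_space I)"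
    using meas le c
    by (intro nn_integral_mono)
       (simp add: emeasure_eq_measure2 fmeasurableD2 ennreal_mult'[symmetric] ennreal_leI)
  also have "\<dots> = ennreal c * (\<integral>\<^sup>+i. emeasure lebesgue (Y i) \<partial>count_space I)"
    by (intro nn_integral_cmult) auto
  also have "(\<integral>\<^sup>+i. emeasure lebesgue (Y i) \<partial>count_space I) = emeasure lebesgue (\<Union>i\<in>I. Y i)"
    using meas by (intro emeasure_UN_countable[symmetric] I disj) auto
  also have "emeasure lebesgue (\<Union>i\<in>I. Y i) = ennreal (measure lebesgue (\<Union>i\<in>I. Y i))"
    using fin by (simp add: emeasure_eq_measure2)
  finally have "emeasure lebesgue (\<Union>i\<in>I. X i) \<le> ennreal (c * measure lebesgue (\<Union>i\<in>I. Y i))"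
    using c by (simp add: ennreal_mult')
  then show ?thesis
    using c by (simp add: measure_def enn2real_leI)
qed

text \<open>
  Maximises, over countable subfamilies, the measure of the union with respect to a finite measure
  equivalent to Lebesgue measure.
\<close>

lemma ex_countable_exhaustion:
  assumes "\<W> \<subseteq> sets borel"
  obtains \<V> where "countable \<V>" "\<V> \<subseteq> \<W>" "\<And>W. W \<in> \<W> \<Longrightarrow> W \<subseteq>\<^sub>L \<Union>\<V>"
proof -
  obtain h :: "real \<Rightarrow> ennreal" where h: "h \<in> borel_measurable lborel" "integral\<^sup>N lborel h \<noteq> \<infinity>" "\<And>x. 0 < h x"
    using sigma_finite_measure.Ex_finite_integrable_function[OF sigma_finite_lborel] by auto
  define \<nu> where "\<nu> = density lborel h"
  have sets [simp]: "sets \<nu> = sets borel"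
    by (simp add: \<nu>_def)
  have fin: "emeasure \<nu> A < top" if "A \<in> sets borel" for A
  proof -
    have "emeasure \<nu> A \<le> emeasure \<nu> UNIV"
      by (intro emeasure_mono) auto
    also have "\<dots> = integral\<^sup>N lborel h"
      using h by (simp add: \<nu>_def emeasure_density)
    finally show ?thesis
      using h(2) by (auto simp: less_top)
  qed
  have null: "negligible A" if "A \<in> sets borel" "emeasure \<nu> A = 0" for A
  proof -
    have "A \<in> null_sets (density lborel h)"
      using that by (auto simp: null_sets_def \<nu>_def)
    then have "AE x in lborel. x \<in> A \<longrightarrow> h x = 0"
      using null_sets_density_iff[OF h(1)] by auto
    then have "AE x in lborel. x \<notin> A"
      using h(3) by (auto elim!: eventually_mono simp: zero_less_iff_neq_zero)
    then show ?thesis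
      by (simp add: negligible_iff_AE_lborel)
  qed
  define \<C> where "\<C> = {\<V>. countable \<V> \<and> \<V> \<subseteq> \<W>}"
  define s where "s = (SUP \<V>\<in>\<C>. emeasure \<nu> (\<Union>\<V>))"
  have "\<C> \<noteq> {}"
    by (auto simp: \<C>_def)
  then obtain f :: "nat \<Rightarrow> ennreal" where f: "range f \<subseteq> (\<lambda>\<V>. emeasure \<nu> (\<Union>\<V>)) ` \<C>" "s = Sup (range f)"
    using ennreal_SUP_countable_SUP[of \<C> "\<lambda>\<V>. emeasure \<nu> (\<Union>\<V>)"] unfolding s_def by metis
  have "\<exists>\<V>\<in>\<C>. f n = emeasure \<nu> (\<Union>\<V>)" for n
    using f(1) by auto
  then obtain V where V: "\<And>n. V n \<in> \<C>" "\<And>n. f n = emeasure \<nu> (\<Union>(V n))"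
    by metis
  define \<V> where "\<V> = (\<Union>n. V n)"
  have \<V>: "\<V> \<in> \<C>"
    using V(1) by (auto simp: \<V>_def \<C>_def)
  have borel: "\<Union>\<U> \<in> sets borel" if "\<U> \<in> \<C>" for \<U>
    using that assms by (intro sets.countable_Union) (auto simp: \<C>_def)
  have "f n \<le> emeasure \<nu> (\<Union>\<V>)" for n
    unfolding V(2) using borel[OF \<V>] by (intro emeasure_mono) (auto simp: \<V>_def)
  then have s: "s \<le> emeasure \<nu> (\<Union>\<V>)"
    unfolding f(2) by (intro SUP_least)
  have "W \<subseteq>\<^sub>L \<Union>\<V>" if W: "W \<in> \<W>" for W
  proof -
    \<comment> \<open>Enlarging \<open>\<V>\<close> by one set cannot exceed the supremum, which
      \<open>\<V>\<close> already attains; as \<open>\<nu>\<close> is finite, cancellation leaves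
      \<open>W - \<Union>\<V>\<close> with measure 0.\<close>
    have "insert W \<V> \<in> \<C>"
      using W \<V> by (auto simp: \<C>_def)
    then have "emeasure \<nu> (\<Union>(insert W \<V>)) \<le> s"
      unfolding s_def by (intro SUP_upper)
    moreover have W': "W \<in> sets borel"
      using W assms by auto
    moreover have "emeasure \<nu> (\<Union>(insert W \<V>)) = emeasure \<nu> (W - \<Union>\<V>) + emeasure \<nu> (\<Union>\<V>)"
      using W' borel[OF \<V>] by (subst plus_emeasure) (auto intro!: arg_cong[where f = "emeasure \<nu>"])
    ultimately have "emeasure \<nu> (W - \<Union>\<V>) + emeasure \<nu> (\<Union>\<V>) \<le> 0 + emeasure \<nu> (\<Union>\<V>)"
      using s by (metis Union_insert add_0 order_trans)
    then have "emeasure \<nu> (W - \<Union>\<V>) \<le> 0"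
      using fin[OF borel[OF \<V>]] by (auto simp: ennreal_add_left_cancel_le add.commute)
    then show ?thesis
      unfolding subset_mod_null_iff using W' borel[OF \<V>] by (intro null) auto
  qed
  with \<V> show thesis
    by (intro that[of \<V>]) (auto simp: \<C>_def)
qed

lemma measure_mono_mod_null:
  assumes "A \<subseteq>\<^sub>L B" "A \<in> sets lebesgue" "B \<in> lmeasurable"
  shows "measure lebesgue A \<le> measure lebesgue B"
proof -
  have meas: "A \<inter> B \<in> lmeasurable"
    using assms by (metis fmeasurable_Int_fmeasurable inf_commute)
  have "measure lebesgue A = measure lebesgue (A \<inter> B)"
    using assms(1) by (intro measure_negligible_symdiff[OF meas]) (simp add: subset_mod_null_iff Diff_Int)
  also have "\<dots> \<le> measure lebesgue B"
    using assms meas by (intro measure_mono_fmeasurable) (auto dest: fmeasurableD)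
  finally show ?thesis .
qed

section \<open>Generic points and the transition relation\<close>

context surjective_markov_map
begin

lemma a_less: "i < j \<Longrightarrow> a i < a j"
proof -
  have "a i < a (i + int (Suc n))" for n
  proof (induction n)
    case (Suc n)
    then show ?case
      using A1(2)[of "i + int (Suc n)"] by (simp add: algebra_simps)
  qed (use A1(2)[of i] in simp)
  then show "a i < a j" if "i < j"
    using that by (metis zless_iff_Suc_zadd)
qed

lemma a_le: "i \<le> j \<Longrightarrow> a i \<le> a j"
  using a_less[of i j] by (cases "i = j") auto

lemma ex_index: "\<exists>j. a j \<le> x \<and> x < a (j + 1)"
proof -
  obtain i where i: "a i \<le> x"
    using a_at_bot by (metis filterlim_at_bot eventually_at_bot_linorder order_refl)
  obtain k where k: "x < a k"
    using a_at_top by (metis filterlim_at_top_dense eventually_at_top_linorder order_refl)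
  define S where "S = {j \<in> {i..k}. a j \<le> x}"
  have S: "finite S" "i \<in> S"
  proof -
    have "i \<le> k"
      using i k a_le[of k i] by linarith
    then show "i \<in> S"
      using i by (simp add: S_def)
    show "finite S"
      unfolding S_def by (rule finite_subset[of _ "{i..k}"]) auto
  qed
  define j where "j = Max S"
  have j: "j \<in> S"
    using S unfolding j_def by (intro Max_in) auto
  have "x < a (j + 1)"
  proof (rule ccontr)
    assume *: "\<not> x < a (j + 1)"
    then have "j \<noteq> k"
      using j k by (auto simp: S_def)
    then have "j + 1 \<in> S"
      using j * by (auto simp: S_def)
    then have "j + 1 \<le> j"
      unfolding j_def using S by (intro Max_ge) auto
    then show False
      by simp
  qed
  with j show ?thesis
    by (auto simp: S_def)
qed

text \<open>Half-open intervals give every real exactly one index. The end points are thereby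
  assigned to the interval on their right, an arbitrary choice on a countable set.\<close>

definition idx :: "real \<Rightarrow> int" where
  "idx x = (THE j. a j \<le> x \<and> x < a (j + 1))"

lemma idx_eqI:
  assumes "a j \<le> x" "x < a (j + 1)"
  shows "idx x = j"
  unfolding idx_def
proof (rule the_equality)
  show "i = j" if "a i \<le> x \<and> x < a (i + 1)" for i
    using that assms a_le[of "i + 1" j] a_le[of "j + 1" i] by linarith
qed (use assms in auto)

lemma idx_bounds: "a (idx x) \<le> x" "x < a (idx x + 1)"
  using ex_index[of x] idx_eqI by metis+

text \<open>On these points the Markov intervals are disjoint and \<open>T\<close> agrees with its
  branches along the whole orbit, so itineraries are exact and not merely almost everywhere
  defined.\<close>

definition generic :: "real set" where
  "generic = {x. \<forall>n. (T ^^ n) x \<notin> range a}"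

lemma generic_notin_range: "x \<in> generic \<Longrightarrow> x \<notin> range a"
  unfolding generic_def by (metis (mono_tags, lifting) funpow_0 mem_Collect_eq)

lemma generic_T_iff: "x \<in> generic \<longleftrightarrow> x \<notin> range a \<and> T x \<in> generic"
proof -
  have "(\<forall>n. P n) \<longleftrightarrow> P 0 \<and> (\<forall>n. P (Suc n))" for P :: "nat \<Rightarrow> bool"
    by (metis not0_implies_Suc)
  from this[of "\<lambda>n. (T ^^ n) x \<notin> range a"] show ?thesis
    unfolding generic_def mem_Collect_eq funpow_Suc_right o_apply funpow_0 .
qed

lemma generic_funpow: "x \<in> generic \<Longrightarrow> (T ^^ n) x \<in> generic"
  by (induction n) (auto dest: generic_T_iff[THEN iffD1])

lemma idx_bounds_strict:
  assumes "x \<notin> range a"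
  shows "a (idx x) < x" "x < a (idx x + 1)"
  using idx_bounds[of x] assms by (metis order_less_le rangeI)+

lemma mem_markov_interval_idx: "x \<in> markov_interval a (idx x)"
  using idx_bounds[of x] by (auto simp: markov_interval_def)

lemma generic_mem_interval_iff: "x \<in> generic \<Longrightarrow> x \<in> markov_interval a j \<longleftrightarrow> idx x = j"
  using generic_notin_range[of x] idx_eqI[of j x] mem_markov_interval_idx[of x]
  by (auto simp: markov_interval_def order_le_less)

text \<open>The transition graph as read off from (A2). \<open>covers_iff\<close> identifies its
  powers with covering by the iterates of \<open>T\<close>.\<close>

definition edge :: "int rel" where
  "edge = {(j, k). k1 j \<le> k \<and> k \<le> k2 j}"

lemma UN_markov_interval: "i \<le> k \<Longrightarrow> (\<Union>j\<in>{i..k}. markov_interval a j) = {a i..a (k + 1)}"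
proof (intro equalityI subsetI)
  fix x assume ik: "i \<le> k" and x: "x \<in> {a i..a (k + 1)}"
  show "x \<in> (\<Union>j\<in>{i..k}. markov_interval a j)"
  proof (cases "x = a (k + 1)")
    case True
    then show ?thesis
      using ik a_less[of k "k + 1"] by (auto simp: markov_interval_def intro!: bexI[of _ k])
  next
    case False
    then have "i \<le> idx x" "idx x \<le> k"
      using x idx_bounds[of x] a_le[of "idx x + 1" i] a_le[of "k + 1" "idx x"] by force+
    then show ?thesis
      using mem_markov_interval_idx[of x] by auto
  qed
next
  fix x assume "x \<in> (\<Union>j\<in>{i..k}. markov_interval a j)"
  then obtain j where "i \<le> j" "j \<le> k" "a j \<le> x" "x \<le> a (j + 1)"
    by (auto simp: markov_interval_def)
  then show "x \<in> {a i..a (k + 1)}"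
    using a_le[of i j] a_le[of "j + 1" "k + 1"] by simp
qed

lemma tau_image: "\<tau> j ` markov_interval a j = {a (k1 j)..a (k2 j + 1)}"
  using A2_bij[of j] UN_markov_interval[OF A2_le, of j] by (simp add: bij_betw_def)

lemma tau_inj: "inj_on (\<tau> j) (markov_interval a j)"
  using A2_bij[of j] by (simp add: bij_betw_def)

lemma tau_continuous: "continuous_on (markov_interval a j) (\<tau> j)"
  using A2_deriv by (meson DERIV_continuous_on)

text \<open>An injective continuous function on an interval is monotone, so end points go to the end
  points of the image, which are again of the form \<open>a i\<close>. Hence a generic point never
  has an end point as its preimage under a branch.\<close>

lemma tau_endpoints:
  assumes "e \<in> {a j, a (j + 1)}"
  shows "\<tau> j e \<in> range a"
proof -
  have le: "a j < a (j + 1)"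
    by (rule a_less) simp
  have "is_interval (markov_interval a j)"
    by (simp add: markov_interval_def is_interval_cc)
  then consider "strict_mono_on (markov_interval a j) (\<tau> j)"
    | "strict_antimono_on (markov_interval a j) (\<tau> j)"
    using injective_eq_monotone_map[OF _ tau_continuous] tau_inj by blast
  then have mono: "(\<forall>x\<in>markov_interval a j. \<forall>y\<in>markov_interval a j. x \<le> y \<longrightarrow> \<tau> j x \<le> \<tau> j y)
      \<or> (\<forall>x\<in>markov_interval a j. \<forall>y\<in>markov_interval a j. x \<le> y \<longrightarrow> \<tau> j y \<le> \<tau> j x)"
    by cases (auto simp: monotone_on_def order_le_less)
  have J: "a (k1 j) \<le> a (k2 j + 1)"
    using A2_le[of j] by (intro a_le) simp
  obtain p where p: "p \<in> markov_interval a j" "\<tau> j p = a (k1 j)"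
    using J tau_image[of j] by (metis atLeastAtMost_iff imageE order_refl)
  obtain q where q: "q \<in> markov_interval a j" "\<tau> j q = a (k2 j + 1)"
    using J tau_image[of j] by (metis atLeastAtMost_iff imageE order_refl)
  have in_J: "\<tau> j x \<in> {a (k1 j)..a (k2 j + 1)}" if "x \<in> markov_interval a j" for x
    using that tau_image[of j] by blast
  have ends: "a j \<in> markov_interval a j" "a (j + 1) \<in> markov_interval a j"
    using le by (auto simp: markov_interval_def)
  have bounds: "a j \<le> x" "x \<le> a (j + 1)" if "x \<in> markov_interval a j" for x
    using that by (auto simp: markov_interval_def)
  have "\<tau> j e = a (k1 j) \<or> \<tau> j e = a (k2 j + 1)"
    using mono
  proof
    assume "\<forall>x\<in>markov_interval a j. \<forall>y\<in>markov_interval a j. x \<le> y \<longrightarrow> \<tau> j x \<le> \<tau> j y"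
    then have "\<tau> j (a j) \<le> a (k1 j)" "a (k2 j + 1) \<le> \<tau> j (a (j + 1))"
      using p q ends bounds by metis+
    then show ?thesis
      using in_J ends assms by force
  next
    assume "\<forall>x\<in>markov_interval a j. \<forall>y\<in>markov_interval a j. x \<le> y \<longrightarrow> \<tau> j y \<le> \<tau> j x"
    then have "\<tau> j (a (j + 1)) \<le> a (k1 j)" "a (k2 j + 1) \<le> \<tau> j (a j)"
      using p q ends bounds by metis+
    then show ?thesis
      using in_J ends assms by force
  qed
  then show ?thesis
    by auto
qed

lemma T_eq_tau: "x \<notin> range a \<Longrightarrow> T x = \<tau> (idx x) x"
  using A2_extends[of x "idx x"] idx_bounds_strict[of x] by simp

lemma generic_edge:
  assumes "x \<in> generic"
  shows "(idx x, idx (T x)) \<in> edge"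
proof -
  have "T x \<in> {a (k1 (idx x))..a (k2 (idx x) + 1)}"
    using tau_image[of "idx x"] mem_markov_interval_idx[of x] T_eq_tau[of x]
      generic_notin_range[OF assms] by auto
  moreover have "T x \<notin> range a"
    using assms generic_T_iff generic_notin_range by blast
  ultimately show ?thesis
    unfolding edge_def
    using idx_bounds_strict[of "T x"] a_le[of "idx (T x) + 1" "k1 (idx x)"]
      a_le[of "k2 (idx x) + 1" "idx (T x)"]
    by force
qed

text \<open>The Markov property pointwise: the branch on \<open>I_j\<close> is onto, and by
  \<open>tau_endpoints\<close> the preimage is interior, so that \<open>T\<close> agrees with the
  branch there and genericity is inherited.\<close>

lemma generic_preimage:
  assumes "z \<in> generic" "(j, idx z) \<in> edge"
  obtains w where "w \<in> generic" "idx w = j" "T w = z"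
proof -
  have "z \<in> (\<Union>k\<in>{k1 j..k2 j}. markov_interval a k)"
    using assms(2) mem_markov_interval_idx[of z] by (auto simp: edge_def)
  then obtain w where w: "w \<in> markov_interval a j" "\<tau> j w = z"
    using A2_bij[of j] unfolding bij_betw_def by (metis imageE)
  have "w \<noteq> a j" "w \<noteq> a (j + 1)"
    using tau_endpoints[of _ j] w generic_notin_range[OF assms(1)] by auto
  with w(1) have w': "a j < w" "w < a (j + 1)"
    by (auto simp: markov_interval_def)
  have "w \<noteq> a i" for i
    using w' a_le[of i j] a_le[of "j + 1" i] by (cases "i \<le> j") auto
  moreover have "T w = z"
    using w w' A2_extends[of w j] by auto
  ultimately show thesis
    using that w' assms(1) idx_eqI[of j w] generic_T_iff[of w] by auto
qed

lemma funpow_idx_edge: "x \<in> generic \<Longrightarrow> (idx x, idx ((T ^^ n) x)) \<in> edge ^^ n"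
  by (induction n) (auto intro: relcompI generic_edge generic_funpow)

lemma generic_preimage_funpow:
  assumes "z \<in> generic" "(j, idx z) \<in> edge ^^ n"
  obtains w where "w \<in> generic" "idx w = j" "(T ^^ n) w = z"
  using assms
proof (induction n arbitrary: z thesis)
  case (Suc n)
  then obtain i where i: "(j, i) \<in> edge ^^ n" "(i, idx z) \<in> edge"
    by auto
  with Suc.prems obtain y where "y \<in> generic" "idx y = i" "T y = z"
    using generic_preimage by blast
  with Suc.IH[of y] i Suc.prems show ?case
    by auto
qed auto

text \<open>Mean value theorem with (A3); absolute values cover increasing and decreasing branches
  alike.\<close>

lemma tau_expanding:
  assumes "x \<in> markov_interval a j" "y \<in> markov_interval a j"
  shows "\<Lambda> * \<bar>x - y\<bar> \<le> \<bar>\<tau> j x - \<tau> j y\<bar>"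
proof -
  have less: "\<Lambda> * \<bar>x - y\<bar> \<le> \<bar>\<tau> j x - \<tau> j y\<bar>"
    if xy: "x \<in> markov_interval a j" "y \<in> markov_interval a j" "x < y" for x y
  proof -
    have sub: "{x..y} \<subseteq> markov_interval a j"
      using xy by (auto simp: markov_interval_def)
    have "(\<tau> j has_derivative (\<lambda>h. \<tau>' j z * h)) (at z within {x..y})" if "x \<le> z" "z \<le> y" for z
      using A2_deriv[of z j] that sub
      by (intro has_derivative_subset[OF _ sub]) (auto simp: has_field_derivative_def)
    then obtain z where z: "z \<in> {x<..<y}" "\<tau> j y - \<tau> j x = \<tau>' j z * (y - x)"
      using mvt_simple[OF xy(3), of "\<tau> j" "\<lambda>z h. \<tau>' j z * h"] by blast
    have "\<Lambda> * (y - x) \<le> \<bar>\<tau>' j z\<bar> * (y - x)"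
      using A3(2)[of z j] z(1) subsetD[OF sub, of z] xy(3) by (intro mult_right_mono) auto
    also have "\<dots> = \<bar>\<tau> j x - \<tau> j y\<bar>"
      using z xy(3) by (simp add: abs_minus_commute[of "\<tau> j x"] abs_mult)
    finally show ?thesis
      using xy(3) by simp
  qed
  then show ?thesis
    using assms less[of x y] less[of y x] by (cases x y rule: linorder_cases) (auto simp: abs_minus_commute)
qed

lemma at_within_markov_interval: "x \<in> {a j<..<a (j + 1)} \<Longrightarrow> at x within markov_interval a j = at x"
  by (simp add: markov_interval_def at_within_Icc_at)

text \<open>
  Cauchy's mean value theorem for \<open>ln ((\<tau>')\<^sup>2) / 2\<close> and \<open>\<tau>\<close> turns (A4) into this bound directly; the
  square avoids a case distinction on the sign of \<open>\<tau>'\<close>.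
\<close>

lemma tau_distortion:
  assumes "x \<in> {a j<..<a (j + 1)}" "y \<in> {a j<..<a (j + 1)}"
  shows "\<bar>ln \<bar>\<tau>' j x\<bar> - ln \<bar>\<tau>' j y\<bar>\<bar> \<le> \<eta> * \<bar>\<tau> j x - \<tau> j y\<bar>"
proof -
  have less: "\<bar>ln \<bar>\<tau>' j x\<bar> - ln \<bar>\<tau>' j y\<bar>\<bar> \<le> \<eta> * \<bar>\<tau> j x - \<tau> j y\<bar>"
    if xy: "x \<in> {a j<..<a (j + 1)}" "y \<in> {a j<..<a (j + 1)}" "x < y" for x y
  proof -
    let ?f = "\<lambda>z. ln ((\<tau>' j z)\<^sup>2) / 2"
    have D: "DERIV (\<tau> j) z :> \<tau>' j z" "DERIV (\<tau>' j) z :> \<tau>'' j z" "\<tau>' j z \<noteq> 0"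
      "\<bar>\<tau>'' j z\<bar> \<le> \<eta> * (\<tau>' j z)\<^sup>2" "?f z = ln \<bar>\<tau>' j z\<bar>"
      if "x \<le> z" "z \<le> y" for z
    proof -
      have z: "z \<in> {a j<..<a (j + 1)}" "z \<in> markov_interval a j"
        using that xy by (auto simp: markov_interval_def)
      show "DERIV (\<tau> j) z :> \<tau>' j z" "DERIV (\<tau>' j) z :> \<tau>'' j z"
        using A2_deriv[OF z(2)] A2_deriv2[OF z(2)] at_within_markov_interval[OF z(1)] by auto
      show nz: "\<tau>' j z \<noteq> 0"
        using A3(1) A3(2)[OF z(2)] by auto
      show "\<bar>\<tau>'' j z\<bar> \<le> \<eta> * (\<tau>' j z)\<^sup>2"
        using A4(2)[OF z(2)] nz by (simp add: pos_divide_le_eq abs_divide)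
      have "ln ((\<tau>' j z)\<^sup>2) = ln (\<bar>\<tau>' j z\<bar>\<^sup>2)"
        by simp
      also have "\<dots> = 2 * ln \<bar>\<tau>' j z\<bar>"
        using nz by (subst ln_realpow) auto
      finally show "?f z = ln \<bar>\<tau>' j z\<bar>"
        by simp
    qed
    have Df: "DERIV ?f z :> \<tau>'' j z / \<tau>' j z" if "x \<le> z" "z \<le> y" for z
      using D(1-3)[OF that] by (auto intro!: derivative_eq_intros simp: power2_eq_square zero_less_mult_iff)
    obtain c where c: "x < c" "c < y"
      "(?f y - ?f x) * \<tau>' j c = (\<tau> j y - \<tau> j x) * (\<tau>'' j c / \<tau>' j c)"
      using GMVT'[OF xy(3), of ?f "\<tau> j" "\<tau>' j" "\<lambda>z. \<tau>'' j z / \<tau>' j z"] D(1) Df DERIV_isCont by force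
    have nz: "\<tau>' j c \<noteq> 0"
      using D(3) c by simp
    have "\<bar>?f y - ?f x\<bar> * \<bar>\<tau>' j c\<bar> = \<bar>\<tau> j y - \<tau> j x\<bar> * (\<bar>\<tau>'' j c\<bar> / \<bar>\<tau>' j c\<bar>)"
      using c(3) by (metis abs_divide abs_mult)
    also have "\<dots> \<le> \<bar>\<tau> j y - \<tau> j x\<bar> * (\<eta> * \<bar>\<tau>' j c\<bar>)"
      using D(4)[of c] c nz by (intro mult_left_mono) (auto simp: pos_divide_le_eq power2_eq_square)
    finally have "\<bar>?f y - ?f x\<bar> * \<bar>\<tau>' j c\<bar> \<le> (\<eta> * \<bar>\<tau> j y - \<tau> j x\<bar>) * \<bar>\<tau>' j c\<bar>"
      by (simp add: mult_ac)
    then have "\<bar>?f y - ?f x\<bar> \<le> \<eta> * \<bar>\<tau> j y - \<tau> j x\<bar>"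
      using nz by (simp add: mult_le_cancel_right)
    then show ?thesis
      using D(5)[of x] D(5)[of y] xy(3) by (simp add: abs_minus_commute)
  qed
  then show ?thesis
    using assms less[of x y] less[of y x] A4(1)
    by (cases x y rule: linorder_cases) (auto simp: abs_minus_commute)
qed

section \<open>Measurability and nonsingularity of the map\<close>

text \<open>Each of the countably many branches is injective, so it contributes at most one preimage
  per point. The end points, where \<open>T\<close> is arbitrary, are added as a whole.\<close>

lemma countable_vimage_T:
  assumes "countable S"
  shows "countable (T -` S)"
proof (rule countable_subset)
  show "T -` S \<subseteq> range a \<union> (\<Union>j. inv_into (markov_interval a j) (\<tau> j) ` S)"
  proof
    fix x assume x: "x \<in> T -` S"
    show "x \<in> range a \<union> (\<Union>j. inv_into (markov_interval a j) (\<tau> j) ` S)"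
    proof (cases "x \<in> range a")
      case False
      then have "x = inv_into (markov_interval a (idx x)) (\<tau> (idx x)) (T x)"
        using T_eq_tau[of x] tau_inj[of "idx x"] mem_markov_interval_idx[of x]
        by (simp add: inv_into_f_f)
      with x have "x \<in> inv_into (markov_interval a (idx x)) (\<tau> (idx x)) ` S"
        by (intro image_eqI) auto
      then show ?thesis
        by blast
    qed auto
  qed
qed (use assms in auto)

lemma countable_not_generic: "countable (- generic)"
proof -
  have "countable ((T ^^ n) -` range a)" for n
  proof (induction n)
    case (Suc n)
    have "(T ^^ Suc n) -` range a = T -` (T ^^ n) -` range a"
      unfolding funpow_Suc_right by auto
    with Suc show ?case
      by (simp only: countable_vimage_T)
  qed auto
  moreover have "- generic = (\<Union>n. (T ^^ n) -` range a)"
    by (auto simp: generic_def)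
  ultimately show ?thesis
    by auto
qed

lemma negligible_not_generic: "negligible (- generic)"
  using countable_not_generic by (simp add: countable_imp_negligible)

lemma subset_mod_null_genericI: "(\<And>x. x \<in> generic \<Longrightarrow> x \<in> A \<Longrightarrow> x \<in> B) \<Longrightarrow> A \<subseteq>\<^sub>L B"
  unfolding subset_mod_null_iff by (rule negligible_subset[OF negligible_not_generic]) auto

lemma generic_borel [measurable]: "generic \<in> sets borel"
  using sets.Diff[OF sets.top, of "- generic" borel] countable_not_generic
  by (simp add: sets.countable borel_closed Compl_eq_Diff_UNIV[symmetric])

lemma markov_interval_borel [measurable]: "markov_interval a j \<in> sets borel"
  by (simp add: markov_interval_def)

text \<open>\<open>T\<close> is continuous on each open Markov interval and trivially on each single
  end point, and these countably many sets cover the line.\<close>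

lemma T_measurable [measurable]: "T \<in> borel_measurable borel"
proof (rule measurable_piecewise_restrict)
  let ?C = "range (\<lambda>j. {a j<..<a (j + 1)}) \<union> range (\<lambda>j. {a j})"
  show "countable ?C"
    by auto
  show "\<Omega> \<inter> space borel \<in> sets borel" if "\<Omega> \<in> ?C" for \<Omega>
    using that by auto
  show "space borel \<subseteq> \<Union>?C"
  proof
    fix x :: real
    show "x \<in> \<Union>?C"
      using idx_bounds_strict[of x] by (cases "x \<in> range a") auto
  qed
  show "T \<in> borel_measurable (restrict_space borel \<Omega>)" if "\<Omega> \<in> ?C" for \<Omega>
  proof (rule borel_measurable_continuous_on_restrict)
    show "continuous_on \<Omega> T"
      using that
    proof
      assume "\<Omega> \<in> range (\<lambda>j. {a j<..<a (j + 1)})"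
      then obtain j where j: "\<Omega> = {a j<..<a (j + 1)}"
        by auto
      have "continuous_on \<Omega> (\<tau> j)"
        by (rule continuous_on_subset[OF tau_continuous]) (auto simp: j markov_interval_def)
      then show ?thesis
        by (rule continuous_on_eq) (simp add: j A2_extends)
    qed auto
  qed
qed

lemma funpow_T_measurable [measurable]: "(T ^^ n) \<in> borel_measurable borel"
  by (induction n) (auto simp: id_def)

lemma vimage_funpow_borel [measurable]: "A \<in> sets borel \<Longrightarrow> (T ^^ n) -` A \<in> sets borel"
  using measurable_sets[OF funpow_T_measurable] by simp

text \<open>The inverse branches are Lipschitz with constant 1, because the branches expand by
  \<open>\<Lambda> > 1\<close>, and Lipschitz images of null sets are null.\<close>

lemma negligible_vimage_T:
  assumes "negligible S"
  shows "negligible (T -` S)"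
proof -
  let ?g = "\<lambda>j. inv_into (markov_interval a j) (\<tau> j)"
  let ?J = "\<lambda>j. S \<inter> \<tau> j ` markov_interval a j"
  have "negligible (?g j ` ?J j)" for j
  proof (rule negligible_locally_Lipschitz_image)
    show "negligible (?J j)"
      using assms by (rule negligible_subset) auto
    fix u assume u: "u \<in> ?J j"
    have "norm (?g j v - ?g j u) \<le> 1 * norm (v - u)" if v: "v \<in> ?J j" for v
    proof -
      have "1 * \<bar>?g j v - ?g j u\<bar> \<le> \<Lambda> * \<bar>?g j v - ?g j u\<bar>"
        using A3(1) by (intro mult_right_mono) auto
      also have "\<dots> \<le> \<bar>\<tau> j (?g j v) - \<tau> j (?g j u)\<bar>"
        using u v by (intro tau_expanding inv_into_into) auto
      also have "\<dots> = \<bar>v - u\<bar>"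
        using u v by (simp add: f_inv_into_f)
      finally show ?thesis
        by simp
    qed
    then show "\<exists>U B. open U \<and> u \<in> U \<and> (\<forall>v\<in>?J j \<inter> U. norm (?g j v - ?g j u) \<le> B * norm (v - u))"
      by blast
  qed simp
  then have "negligible (range a \<union> (\<Union>j. ?g j ` ?J j))"
    by (intro negligible_Un negligible_countable_Union) (auto intro: countable_imp_negligible)
  then show ?thesis
  proof (rule negligible_subset, intro subsetI)
    fix x assume x: "x \<in> T -` S"
    show "x \<in> range a \<union> (\<Union>j. ?g j ` ?J j)"
    proof (cases "x \<in> range a")
      case False
      then have "x = ?g (idx x) (T x)" "T x \<in> ?J (idx x)"
        using x T_eq_tau[of x] tau_inj[of "idx x"] mem_markov_interval_idx[of x]
        by (auto simp: inv_into_f_f)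
      then have "x \<in> ?g (idx x) ` ?J (idx x)"
        by (rule image_eqI)
      then show ?thesis
        by blast
    qed auto
  qed
qed

text \<open>Differentiable images of null sets are null. This direction is needed because
  accessibility and invariant hulls are formed with forward images.\<close>

lemma negligible_image_T:
  assumes "negligible S"
  shows "negligible (T ` S)"
proof -
  have "negligible (\<tau> j ` (S \<inter> markov_interval a j))" for j
  proof (rule negligible_differentiable_image_negligible)
    show "\<tau> j differentiable_on S \<inter> markov_interval a j"
      using A2_deriv[of _ j] unfolding differentiable_on_def has_field_derivative_def
      by (meson IntD2 inf_le2 differentiable_within_subset differentiableI)
  qed (use assms in \<open>auto intro: negligible_subset\<close>)
  then have "negligible (T ` range a \<union> (\<Union>j. \<tau> j ` (S \<inter> markov_interval a j)))"
    by (intro negligible_Un negligible_countable_Union) (auto intro: countable_imp_negligible)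
  then show ?thesis
  proof (rule negligible_subset, intro subsetI)
    fix y assume "y \<in> T ` S"
    then obtain x where "x \<in> S" "y = T x"
      by auto
    then show "y \<in> T ` range a \<union> (\<Union>j. \<tau> j ` (S \<inter> markov_interval a j))"
      using T_eq_tau[of x] mem_markov_interval_idx[of x] by (cases "x \<in> range a") auto
  qed
qed

lemma negligible_vimage_funpow: "negligible S \<Longrightarrow> negligible ((T ^^ n) -` S)"
proof (induction n)
  case (Suc n)
  have "(T ^^ Suc n) -` S = T -` (T ^^ n) -` S"
    unfolding funpow_Suc_right by auto
  with Suc show ?case
    by (simp only: negligible_vimage_T)
qed auto

lemma negligible_image_funpow: "negligible S \<Longrightarrow> negligible ((T ^^ n) ` S)"
proof (induction n)
  case (Suc n)
  have "(T ^^ Suc n) ` S = T ` (T ^^ n) ` S"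
    by (simp add: image_comp)
  with Suc show ?case
    by (simp only: negligible_image_T)
qed auto


section \<open>Cylinders and bounded distortion\<close>

text \<open>The range \<open>i \<le> n\<close> includes \<open>n\<close>: the cylinder fixes
  \<open>n + 1\<close> indices, so that \<open>T ^^ n\<close> maps it onto the generic points of
  exactly one Markov interval and not of a union of several.\<close>

definition cyl :: "nat \<Rightarrow> real \<Rightarrow> real set" where
  "cyl n x = {y \<in> generic. \<forall>i\<le>n. idx ((T ^^ i) y) = idx ((T ^^ i) x)}"

lemma cyl_self: "x \<in> generic \<Longrightarrow> x \<in> cyl n x"
  by (simp add: cyl_def)

lemma cyl_generic: "y \<in> cyl n x \<Longrightarrow> y \<in> generic"
  by (simp add: cyl_def)

lemma cyl_eq: "y \<in> cyl n x \<Longrightarrow> m \<le> n \<Longrightarrow> cyl m y = cyl m x"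
  by (auto simp: cyl_def)

lemma cyl_idx: "y \<in> cyl n x \<Longrightarrow> i \<le> n \<Longrightarrow> idx ((T ^^ i) y) = idx ((T ^^ i) x)"
  by (simp add: cyl_def)

lemma cyl_Suc: "cyl (Suc n) x \<subseteq> cyl n x"
  by (auto simp: cyl_def)

lemma cyl_subset: "cyl n x \<subseteq> markov_interval a (idx x)"
proof
  fix y assume "y \<in> cyl n x"
  then have "y \<in> generic" "idx y = idx x"
    using cyl_idx[of y n x 0] cyl_generic by auto
  then show "y \<in> markov_interval a (idx x)"
    by (simp add: generic_mem_interval_iff)
qed

lemma countable_cylinders: "countable {cyl n x | n x. True}"
proof (rule countable_subset)
  \<comment> \<open>A cylinder is determined by its rank and its itinerary, which is a finite list
    of integers.\<close>
  let ?h = "\<lambda>y n. map (\<lambda>i. idx ((T ^^ i) y)) [0..<Suc n]"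
  show "{cyl n x | n x. True} \<subseteq> range (\<lambda>(n, l). {y \<in> generic. ?h y n = l})"
  proof
    fix C assume "C \<in> {cyl n x | n x. True}"
    then obtain n x where "C = cyl n x"
      by auto
    then have "C = (\<lambda>(n, l). {y \<in> generic. ?h y n = l}) (n, ?h x n)"
      by (auto simp: cyl_def less_Suc_eq_le simp del: upt_Suc)
    then show "C \<in> range (\<lambda>(n, l). {y \<in> generic. ?h y n = l})"
      by blast
  qed
qed simp

lemma idx_vimage_borel [measurable]: "{z. idx z = j} \<in> sets borel"
proof -
  have "{z. idx z = j} = {a j..<a (j + 1)}"
    using idx_bounds idx_eqI by auto
  then show ?thesis
    by simp
qed

lemma cyl_borel [measurable]: "cyl n x \<in> sets borel"
proof -
  have "cyl n x = generic \<inter> (\<Inter>i\<in>{..n}. (T ^^ i) -` {z. idx z = idx ((T ^^ i) x)})"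
    by (auto simp: cyl_def)
  also have "\<dots> \<in> sets borel"
    by (intro sets.Int sets.finite_INT vimage_funpow_borel) auto
  finally show ?thesis .
qed

lemma interval_subset_lmeasurable:
  assumes "A \<in> sets lebesgue" "A \<subseteq> markov_interval a j"
  shows "A \<in> lmeasurable"
  using assms bounded_subset[OF bounded_closed_interval[of "a j" "a (j + 1)"]]
  by (intro bounded_set_imp_lmeasurable) (auto simp: markov_interval_def)

lemma borel_imp_lebesgue: "A \<in> sets borel \<Longrightarrow> A \<in> sets lebesgue"
  by (simp add: sets_completionI_sets)

lemma measure_markov_interval: "measure lebesgue (markov_interval a j) = a (j + 1) - a j"
  using a_le[of j "j + 1"] by (simp add: markov_interval_def)

lemma measure_markov_interval_pos: "measure lebesgue (markov_interval a j) > 0"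
  using A1(2)[of j] by (simp add: measure_markov_interval)

lemma not_negligible_markov_interval: "\<not> negligible (markov_interval a j)"
  using measure_markov_interval_pos[of j] negligible_imp_measure0 by force

lemma interval_diff_le: "x \<in> markov_interval a j \<Longrightarrow> y \<in> markov_interval a j \<Longrightarrow> \<bar>x - y\<bar> \<le> \<theta>"
  using A1(3)[of j] by (auto simp: markov_interval_def)

lemma cyl_T_diff_le:
  assumes "x \<in> generic" "y \<in> cyl n x"
  shows "\<bar>(T ^^ n) x - (T ^^ n) y\<bar> \<le> \<theta>"
  using mem_markov_interval_idx[of "(T ^^ n) x"] mem_markov_interval_idx[of "(T ^^ n) y"]
    cyl_idx[OF assms(2), of n] by (intro interval_diff_le) auto

text \<open>Points of a cylinder of rank \<open>n\<close> still share their index at time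
  \<open>n\<close>, so the step from \<open>n\<close> to \<open>Suc n\<close> uses a single branch,
  to which expansion and distortion bounds apply.\<close>

lemma cyl_tau:
  assumes "x \<in> generic" "y \<in> cyl n x"
  shows "(T ^^ Suc n) x = \<tau> (idx ((T ^^ n) x)) ((T ^^ n) x)"
    and "(T ^^ Suc n) y = \<tau> (idx ((T ^^ n) x)) ((T ^^ n) y)"
    and "(T ^^ n) x \<in> {a (idx ((T ^^ n) x))<..<a (idx ((T ^^ n) x) + 1)}"
    and "(T ^^ n) y \<in> {a (idx ((T ^^ n) x))<..<a (idx ((T ^^ n) x) + 1)}"
proof -
  have "(T ^^ n) x \<notin> range a" "(T ^^ n) y \<notin> range a"
    using assms generic_funpow generic_notin_range cyl_generic by blast+
  moreover have "idx ((T ^^ n) y) = idx ((T ^^ n) x)"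
    using assms by (simp add: cyl_idx)
  ultimately show "(T ^^ Suc n) x = \<tau> (idx ((T ^^ n) x)) ((T ^^ n) x)"
    and "(T ^^ Suc n) y = \<tau> (idx ((T ^^ n) x)) ((T ^^ n) y)"
    and "(T ^^ n) x \<in> {a (idx ((T ^^ n) x))<..<a (idx ((T ^^ n) x) + 1)}"
    and "(T ^^ n) y \<in> {a (idx ((T ^^ n) x))<..<a (idx ((T ^^ n) x) + 1)}"
    using T_eq_tau idx_bounds_strict by (metis funpow.simps(2) o_apply greaterThanLessThan_iff)+
qed

lemma cyl_expanding_Suc:
  assumes "x \<in> generic" "y \<in> cyl n x"
  shows "\<Lambda> * \<bar>(T ^^ n) x - (T ^^ n) y\<bar> \<le> \<bar>(T ^^ Suc n) x - (T ^^ Suc n) y\<bar>"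
  unfolding cyl_tau(1,2)[OF assms] using cyl_tau(3,4)[OF assms]
  by (intro tau_expanding) (auto simp: markov_interval_def)

lemma cyl_expanding:
  assumes "x \<in> generic" "y \<in> cyl n x"
  shows "\<Lambda> ^ n * \<bar>x - y\<bar> \<le> \<bar>(T ^^ n) x - (T ^^ n) y\<bar>"
  using assms
proof (induction n)
  case (Suc n)
  then have y: "y \<in> cyl n x"
    using cyl_Suc by blast
  have "\<Lambda> ^ Suc n * \<bar>x - y\<bar> = \<Lambda> * (\<Lambda> ^ n * \<bar>x - y\<bar>)"
    by simp
  also have "\<dots> \<le> \<Lambda> * \<bar>(T ^^ n) x - (T ^^ n) y\<bar>"
    using Suc.IH[OF Suc.prems(1) y] A3(1) by (intro mult_left_mono) auto
  also have "\<dots> \<le> \<bar>(T ^^ Suc n) x - (T ^^ Suc n) y\<bar>"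
    using cyl_expanding_Suc[OF Suc.prems(1) y] .
  finally show ?case .
qed simp

text \<open>Two points of a cylinder of rank \<open>n\<close> have images at distance at most
  \<open>\<theta>\<close> under \<open>T ^^ n\<close>, so by expansion their own distance is at most
  \<open>\<theta> / \<Lambda> ^ n\<close>.\<close>

lemma ex_cyl_subset_open:
  assumes "x \<in> generic" "open U" "x \<in> U"
  obtains N where "\<And>n. n \<ge> N \<Longrightarrow> cyl n x \<subseteq> U"
proof -
  obtain e where e: "e > 0" "ball x e \<subseteq> U"
    using assms open_contains_ball by blast
  obtain N where N: "\<theta> / e < \<Lambda> ^ N"
    using real_arch_pow[OF A3(1)] by blast
  have "cyl n x \<subseteq> U" if "n \<ge> N" for n
  proof
    fix y assume y: "y \<in> cyl n x"
    have "\<Lambda> ^ n * \<bar>x - y\<bar> \<le> \<theta>"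
      using cyl_expanding[OF assms(1) y] cyl_T_diff_le[OF assms(1) y] by linarith
    also have "\<theta> < \<Lambda> ^ N * e"
      using N e by (simp add: pos_divide_less_eq)
    also have "\<dots> \<le> \<Lambda> ^ n * e"
      using that A3(1) e by (intro mult_right_mono power_increasing) auto
    finally have "\<bar>x - y\<bar> < e"
      using A3(1) by simp
    then show "y \<in> U"
      using e by (auto simp: dist_real_def)
  qed
  then show thesis
    using that by blast
qed

lemma inj_on_cyl: "inj_on (T ^^ n) (cyl n x)"
proof (rule inj_onI)
  fix u v assume uv: "u \<in> cyl n x" "v \<in> cyl n x" "(T ^^ n) u = (T ^^ n) v"
  then have "v \<in> cyl n u" "u \<in> generic"
    using cyl_eq[of u n x n] cyl_generic by auto
  then have "\<Lambda> ^ n * \<bar>u - v\<bar> \<le> 0"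
    using cyl_expanding[of u v n] uv(3) by simp
  moreover have "\<Lambda> ^ n > 0"
    using A3(1) by (intro zero_less_power) simp
  ultimately show "u = v"
    by (simp add: mult_le_0_iff)
qed

text \<open>The point is pulled back one branch at a time along the itinerary of
  \<open>x\<close>.\<close>

lemma cyl_surj:
  assumes "x \<in> generic" "z \<in> generic" "idx z = idx ((T ^^ n) x)"
  obtains y where "y \<in> cyl n x" "(T ^^ n) y = z"
  using assms
proof (induction n arbitrary: z thesis)
  case 0
  then show ?case
    by (auto simp: cyl_def)
next
  case (Suc n)
  have "(idx ((T ^^ n) x), idx z) \<in> edge"
    using generic_edge[OF generic_funpow[OF Suc.prems(2)], of n] Suc.prems(4) by simp
  then obtain w where w: "w \<in> generic" "idx w = idx ((T ^^ n) x)" "T w = z"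
    using generic_preimage Suc.prems(3) by blast
  then obtain y where "y \<in> cyl n x" "(T ^^ n) y = w"
    using Suc.IH[of w] Suc.prems by blast
  with w Suc.prems show ?case
    by (intro Suc.prems(1)[of y]) (auto simp: cyl_def le_Suc_eq)
qed

lemma cyl_image:
  assumes "x \<in> generic"
  shows "(T ^^ n) ` (cyl n x \<inter> (T ^^ n) -` B) = B \<inter> markov_interval a (idx ((T ^^ n) x)) \<inter> generic"
proof (intro equalityI subsetI)
  fix z assume "z \<in> (T ^^ n) ` (cyl n x \<inter> (T ^^ n) -` B)"
  then obtain y where y: "y \<in> cyl n x" "(T ^^ n) y \<in> B" "z = (T ^^ n) y"
    by auto
  then have "z \<in> generic" "idx z = idx ((T ^^ n) x)"
    using cyl_idx[of y n x n] cyl_generic generic_funpow by auto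
  with y show "z \<in> B \<inter> markov_interval a (idx ((T ^^ n) x)) \<inter> generic"
    using generic_mem_interval_iff by auto
next
  fix z assume z: "z \<in> B \<inter> markov_interval a (idx ((T ^^ n) x)) \<inter> generic"
  then have "idx z = idx ((T ^^ n) x)"
    using generic_mem_interval_iff by auto
  then obtain y where "y \<in> cyl n x" "(T ^^ n) y = z"
    using cyl_surj[OF assms] z by blast
  with z show "z \<in> (T ^^ n) ` (cyl n x \<inter> (T ^^ n) -` B)"
    by auto
qed

section \<open>Derivatives of the iterates and their distortion\<close>

definition Tderiv :: "nat \<Rightarrow> real \<Rightarrow> real" where
  "Tderiv n x = (\<Prod>i<n. \<tau>' (idx ((T ^^ i) x)) ((T ^^ i) x))"

lemma T_has_derivative:
  assumes "x \<notin> range a"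
  shows "DERIV T x :> \<tau>' (idx x) x"
proof (rule has_field_derivative_transform_within_open)
  have "x \<in> {a (idx x)<..<a (idx x + 1)}"
    using idx_bounds_strict[OF assms] by simp
  then show "DERIV (\<tau> (idx x)) x :> \<tau>' (idx x) x" "x \<in> {a (idx x)<..<a (idx x + 1)}"
    using A2_deriv[OF mem_markov_interval_idx] at_within_markov_interval by metis+
qed (auto simp: A2_extends)

lemma Tderiv: "x \<in> generic \<Longrightarrow> DERIV (T ^^ n) x :> Tderiv n x"
proof (induction n)
  case (Suc n)
  have "DERIV T ((T ^^ n) x) :> \<tau>' (idx ((T ^^ n) x)) ((T ^^ n) x)"
    using Suc.prems generic_funpow generic_notin_range by (intro T_has_derivative) blast
  from DERIV_chain'[OF Suc.IH[OF Suc.prems] this] show ?case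
    by (simp add: Tderiv_def o_def mult.commute)
qed (simp add: Tderiv_def id_def)

lemma Tderiv_nonzero: "Tderiv n x \<noteq> 0"
proof -
  have "\<tau>' (idx z) z \<noteq> 0" for z
    using A3(1) A3(2)[OF mem_markov_interval_idx, of z] by auto
  then show ?thesis
    by (simp add: Tderiv_def)
qed

text \<open>
  \<open>K = \<eta> \<Lambda> / (\<Lambda> - 1)\<close> is the fixed point of \<open>K = K / \<Lambda> + \<eta>\<close>, the recursion that arises when one
  more branch is composed.
\<close>

definition distortion :: real where
  "distortion = exp (\<eta> * \<Lambda> / (\<Lambda> - 1) * \<theta>)"

lemma distortion_ge_1: "distortion \<ge> 1"
  using A1(1) A3(1) A4(1) by (simp add: distortion_def)

text \<open>Keeping the distance of the images in the bound, instead of \<open>\<theta>\<close>,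
  lets the induction close: by expansion, the bound for rank \<open>n\<close> is smaller by the
  factor \<open>\<Lambda>\<close> when expressed through the images one step later, which makes room
  for the contribution of the new branch.\<close>

lemma Tderiv_log_distortion:
  assumes "x \<in> generic" "y \<in> cyl n x"
  shows "\<bar>ln \<bar>Tderiv n x\<bar> - ln \<bar>Tderiv n y\<bar>\<bar> \<le> \<eta> * \<Lambda> / (\<Lambda> - 1) * \<bar>(T ^^ n) x - (T ^^ n) y\<bar>"
  using assms
proof (induction n)
  case 0
  then show ?case
    using A3(1) A4(1) by (simp add: Tderiv_def)
next
  case (Suc n)
  define K where "K = \<eta> * \<Lambda> / (\<Lambda> - 1)"
  have y: "y \<in> cyl n x"
    using Suc.prems cyl_Suc by blast
  let ?j = "idx ((T ^^ n) x)"
  let ?u = "(T ^^ n) x" and ?v = "(T ^^ n) y"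
  have j: "idx ?v = ?j"
    using cyl_idx[OF y] by simp
  have nz: "\<tau>' ?j ?u \<noteq> 0" "\<tau>' ?j ?v \<noteq> 0"
    using A3(1) A3(2)[OF mem_markov_interval_idx[of ?u]] A3(2)[OF mem_markov_interval_idx[of ?v]] j
    by auto
  have "Tderiv (Suc n) x = Tderiv n x * \<tau>' ?j ?u" "Tderiv (Suc n) y = Tderiv n y * \<tau>' ?j ?v"
    using j by (simp_all add: Tderiv_def)
  then have "ln \<bar>Tderiv (Suc n) x\<bar> = ln \<bar>Tderiv n x\<bar> + ln \<bar>\<tau>' ?j ?u\<bar>"
    "ln \<bar>Tderiv (Suc n) y\<bar> = ln \<bar>Tderiv n y\<bar> + ln \<bar>\<tau>' ?j ?v\<bar>"
    using nz Tderiv_nonzero by (simp_all add: abs_mult ln_mult_pos)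
  then have "\<bar>ln \<bar>Tderiv (Suc n) x\<bar> - ln \<bar>Tderiv (Suc n) y\<bar>\<bar>
      \<le> \<bar>ln \<bar>Tderiv n x\<bar> - ln \<bar>Tderiv n y\<bar>\<bar> + \<bar>ln \<bar>\<tau>' ?j ?u\<bar> - ln \<bar>\<tau>' ?j ?v\<bar>\<bar>"
    by linarith
  also have "\<dots> \<le> K * \<bar>?u - ?v\<bar> + \<eta> * \<bar>(T ^^ Suc n) x - (T ^^ Suc n) y\<bar>"
    unfolding cyl_tau(1,2)[OF Suc.prems(1) y] K_def
    by (intro add_mono Suc.IH tau_distortion cyl_tau(3,4)[OF Suc.prems(1) y] Suc.prems(1) y)
  also have "\<dots> \<le> K / \<Lambda> * \<bar>(T ^^ Suc n) x - (T ^^ Suc n) y\<bar> + \<eta> * \<bar>(T ^^ Suc n) x - (T ^^ Suc n) y\<bar>"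
  proof -
    have "K * \<bar>?u - ?v\<bar> = K / \<Lambda> * (\<Lambda> * \<bar>?u - ?v\<bar>)"
      using A3(1) by simp
    also have "\<dots> \<le> K / \<Lambda> * \<bar>(T ^^ Suc n) x - (T ^^ Suc n) y\<bar>"
      using cyl_expanding_Suc[OF Suc.prems(1) y] A3(1) A4(1) by (intro mult_left_mono) (auto simp: K_def)
    finally show ?thesis
      by simp
  qed
  also have "\<dots> = (K / \<Lambda> + \<eta>) * \<bar>(T ^^ Suc n) x - (T ^^ Suc n) y\<bar>"
    by (simp add: algebra_simps)
  also have "K / \<Lambda> + \<eta> = K"
    using A3(1) by (simp add: K_def field_simps)
  finally show ?case
    by (simp add: K_def)
qed

lemma Tderiv_distortion:
  assumes "x \<in> generic" "y \<in> cyl n x"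
  shows "\<bar>Tderiv n y\<bar> \<le> distortion * \<bar>Tderiv n x\<bar>" "\<bar>Tderiv n x\<bar> / distortion \<le> \<bar>Tderiv n y\<bar>"
proof -
  let ?K = "\<eta> * \<Lambda> / (\<Lambda> - 1)"
  have "\<bar>ln \<bar>Tderiv n x\<bar> - ln \<bar>Tderiv n y\<bar>\<bar> \<le> ?K * \<bar>(T ^^ n) x - (T ^^ n) y\<bar>"
    by (rule Tderiv_log_distortion[OF assms])
  also have "\<dots> \<le> ?K * \<theta>"
    using A3(1) A4(1) by (intro mult_left_mono cyl_T_diff_le assms) auto
  finally have *: "\<bar>ln \<bar>Tderiv n x\<bar> - ln \<bar>Tderiv n y\<bar>\<bar> \<le> ln distortion"
    by (simp add: distortion_def)
  have pos: "\<bar>Tderiv n x\<bar> > 0" "\<bar>Tderiv n y\<bar> > 0" "distortion > 0"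
    using Tderiv_nonzero distortion_ge_1 by auto
  have "ln \<bar>Tderiv n y\<bar> \<le> ln (distortion * \<bar>Tderiv n x\<bar>)"
    using * pos by (simp add: ln_mult_pos)
  then show "\<bar>Tderiv n y\<bar> \<le> distortion * \<bar>Tderiv n x\<bar>"
    using pos by (subst (asm) ln_le_cancel_iff) auto
  have "ln \<bar>Tderiv n x\<bar> \<le> ln (\<bar>Tderiv n y\<bar> * distortion)"
    using * pos by (simp add: ln_mult_pos)
  then have "\<bar>Tderiv n x\<bar> \<le> \<bar>Tderiv n y\<bar> * distortion"
    using pos by (subst (asm) ln_le_cancel_iff) auto
  then show "\<bar>Tderiv n x\<bar> / distortion \<le> \<bar>Tderiv n y\<bar>"
    using pos by (simp add: pos_divide_le_eq)
qed

lemma measure_Int_generic: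
  assumes "A \<in> lmeasurable"
  shows "measure lebesgue (A \<inter> generic) = measure lebesgue A"
  by (rule measure_negligible_symdiff[OF assms])
     (rule negligible_subset[OF negligible_not_generic], auto)

text \<open>Up to the factor \<open>distortion\<^sup>2\<close>, the proportion of \<open>B\<close>
  in the image interval is at most that of its preimage in the cylinder; the inequality is
  cross-multiplied to avoid quotients. One factor \<open>distortion\<close> comes from the upper
  derivative bound on the preimage of \<open>B\<close>, the other from the lower bound on the whole
  cylinder.\<close>

lemma measure_cyl_vimage:
  assumes x: "x \<in> generic" and B: "B \<in> sets borel" and l: "l = idx ((T ^^ n) x)"
  shows "measure lebesgue (B \<inter> markov_interval a l) * measure lebesgue (cyl n x)
    \<le> distortion\<^sup>2 * measure lebesgue (cyl n x \<inter> (T ^^ n) -` B) * measure lebesgue (markov_interval a l)"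
proof -
  let ?X = "cyl n x \<inter> (T ^^ n) -` B"
  \<comment> \<open>Common reference value: on the cylinder, \<open>\<bar>Tderiv n y\<bar>\<close>
    lies between \<open>?d / distortion\<close> and \<open>distortion * ?d\<close>.\<close>
  let ?d = "\<bar>Tderiv n x\<bar>"
  have D: "distortion > 0"
    using distortion_ge_1 by simp
  have X: "?X \<in> lmeasurable" "cyl n x \<in> lmeasurable"
    using B cyl_subset[of n x]
    by (auto intro!: interval_subset_lmeasurable[of _ "idx x"] borel_imp_lebesgue sets.Int vimage_funpow_borel cyl_borel)
  have Il: "B \<inter> markov_interval a l \<in> lmeasurable" "markov_interval a l \<in> lmeasurable"
    using B by (auto intro!: interval_subset_lmeasurable[of _ l] borel_imp_lebesgue sets.Int markov_interval_borel)
  have Il': "B \<inter> markov_interval a l \<inter> generic \<in> lmeasurable" "markov_interval a l \<inter> generic \<in> lmeasurable"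
    using B by (auto intro!: interval_subset_lmeasurable[of _ l] borel_imp_lebesgue sets.Int markov_interval_borel generic_borel)
  have deriv: "((T ^^ n) has_real_derivative Tderiv n y) (at y within S)" if "y \<in> cyl n x" for y S
    using Tderiv[OF cyl_generic[OF that]] by (rule has_field_derivative_at_within)
  have img: "(T ^^ n) ` ?X = B \<inter> markov_interval a l \<inter> generic" "(T ^^ n) ` cyl n x = markov_interval a l \<inter> generic"
    using cyl_image[OF x, of n B] cyl_image[OF x, of n UNIV] l by auto
  have "measure lebesgue (B \<inter> markov_interval a l) = measure lebesgue ((T ^^ n) ` ?X)"
    by (simp add: img measure_Int_generic[OF Il(1)])
  also have "\<dots> \<le> distortion * ?d * measure lebesgue ?X"
    by (rule measure_image_bounds(2)[of ?X _ "Tderiv n" 0])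
       (use X Il' deriv Tderiv_distortion[OF x] in \<open>auto simp: img intro: inj_on_subset[OF inj_on_cyl]\<close>)
  finally have 1: "measure lebesgue (B \<inter> markov_interval a l) \<le> distortion * ?d * measure lebesgue ?X" .
  have "?d / distortion * measure lebesgue (cyl n x) \<le> measure lebesgue ((T ^^ n) ` cyl n x)"
    by (rule measure_image_bounds(1)[of _ _ "Tderiv n" _ "distortion * ?d"])
       (use X Il' deriv Tderiv_distortion[OF x] in \<open>auto simp: img inj_on_cyl\<close>)
  also have "\<dots> = measure lebesgue (markov_interval a l)"
    by (simp add: img measure_Int_generic[OF Il(2)])
  finally have 2: "?d / distortion * measure lebesgue (cyl n x) \<le> measure lebesgue (markov_interval a l)" .
  have "measure lebesgue (B \<inter> markov_interval a l) * measure lebesgue (cyl n x)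
      \<le> distortion * ?d * measure lebesgue ?X * measure lebesgue (cyl n x)"
    using 1 by (intro mult_right_mono) auto
  also have "\<dots> = distortion\<^sup>2 * measure lebesgue ?X * (?d / distortion * measure lebesgue (cyl n x))"
    using D by (simp add: power2_eq_square)
  also have "\<dots> \<le> distortion\<^sup>2 * measure lebesgue ?X * measure lebesgue (markov_interval a l)"
    using 2 by (intro mult_left_mono) auto
  finally show ?thesis .
qed

section \<open>Conservative and dissipative parts\<close>

lemma vimage_funpow_mono: "A \<subseteq>\<^sub>L B \<Longrightarrow> (T ^^ n) -` A \<subseteq>\<^sub>L (T ^^ n) -` B"
  using negligible_vimage_funpow[of "A - B" n] by (simp add: subset_mod_null_iff vimage_Diff)

lemma image_funpow_mono:
  assumes "A \<subseteq>\<^sub>L B"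
  shows "(T ^^ n) ` A \<subseteq>\<^sub>L (T ^^ n) ` B"
  unfolding subset_mod_null_iff
  by (rule negligible_subset[OF negligible_image_funpow[of "A - B" n]])
     (use assms in \<open>auto simp: subset_mod_null_iff\<close>)

lemma vimage_T_funpow: "T -` (T ^^ n) -` A = (T ^^ Suc n) -` A" "(T ^^ n) -` T -` A = (T ^^ Suc n) -` A"
  unfolding funpow_Suc_right by auto (metis funpow_swap1)+

lemma forward_invariant_funpow:
  assumes "A \<subseteq>\<^sub>L T -` A"
  shows "A \<subseteq>\<^sub>L (T ^^ n) -` A"
proof (induction n)
  case (Suc n)
  note Suc
  also have "(T ^^ n) -` A \<subseteq>\<^sub>L (T ^^ n) -` T -` A"
    by (rule vimage_funpow_mono[OF assms])
  finally show ?case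
    by (simp only: vimage_T_funpow)
qed (simp add: subset_imp_subset_mod_null)

lemma image_forward_invariant:
  assumes "A \<subseteq>\<^sub>L T -` A" "S \<subseteq>\<^sub>L A"
  shows "(T ^^ n) ` S \<subseteq>\<^sub>L A"
proof -
  have "S \<subseteq>\<^sub>L (T ^^ n) -` A"
    using assms(2) forward_invariant_funpow[OF assms(1)] by (rule subset_mod_null_trans)
  then have "(T ^^ n) ` S \<subseteq>\<^sub>L (T ^^ n) ` (T ^^ n) -` A"
    by (rule image_funpow_mono)
  also have "(T ^^ n) ` (T ^^ n) -` A \<subseteq>\<^sub>L A"
    by (rule subset_imp_subset_mod_null) auto
  finally show ?thesis .
qed

text \<open>The iterated preimages of the preimage of \<open>W\<close> are those of
  \<open>W\<close>, shifted by one.\<close>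

lemma wandering_vimage_T: "wandering T W \<Longrightarrow> wandering T (T -` W)"
  unfolding wandering_def eq_mod_null_empty_iff
proof (intro conjI allI impI)
  fix i j :: nat
  assume W: "W \<in> sets borel \<and> (\<forall>i j. i \<noteq> j \<longrightarrow> negligible ((T ^^ i) -` W \<inter> (T ^^ j) -` W))"
  show "T -` W \<in> sets borel"
    using W vimage_funpow_borel[of W 1] by simp
  assume "i \<noteq> j"
  then have "Suc i \<noteq> Suc j"
    by simp
  then have "negligible ((T ^^ Suc i) -` W \<inter> (T ^^ Suc j) -` W)"
    by (rule W[THEN conjunct2, rule_format])
  then show "negligible ((T ^^ i) -` T -` W \<inter> (T ^^ j) -` T -` W)"
    by (simp only: vimage_T_funpow)
qed

text \<open>A countable exhausting family of wandering sets shows that a measurable union exists, so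
  the choice in \<open>measurable_union\<close> yields one. Countability also lets preimages of the
  dissipative part be computed modulo null sets.\<close>

lemma dissipative_part_union:
  obtains \<V> where "countable \<V>" "\<And>W. W \<in> \<V> \<Longrightarrow> wandering T W"
    "dissipative_part T \<subseteq>\<^sub>L \<Union>\<V>"
    "dissipative_part T \<in> sets borel"
    "\<And>W. wandering T W \<Longrightarrow> W \<subseteq>\<^sub>L dissipative_part T"
proof -
  have wandering: "{W. wandering T W} \<subseteq> sets borel"
    by (auto simp: wandering_def)
  obtain \<V> where \<V>: "countable \<V>" "\<V> \<subseteq> {W. wandering T W}"
    "\<And>W. W \<in> {W. wandering T W} \<Longrightarrow> W \<subseteq>\<^sub>L \<Union>\<V>"
    using ex_countable_exhaustion[OF wandering] by blast
  have borel: "\<Union>\<V> \<in> sets borel"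
    using \<V>(1,2) wandering by (intro sets.countable_Union) auto
  have union: "\<Union>\<V> \<subseteq>\<^sub>L U" if "\<And>W. wandering T W \<Longrightarrow> W \<subseteq>\<^sub>L U" for U
    using subset_mod_null_UN[of \<V> "\<lambda>W. W" U] \<V> that by auto
  have "is_measurable_union {W. wandering T W} (\<Union>\<V>)"
    using \<V>(3) borel union by (auto simp: is_measurable_union_def)
  then have *: "is_measurable_union {W. wandering T W} (dissipative_part T)"
    unfolding dissipative_part_def measurable_union_def by (rule someI)
  show thesis
  proof (rule that[of \<V>])
    show "dissipative_part T \<subseteq>\<^sub>L \<Union>\<V>"
      using * \<V>(3) borel by (auto simp: is_measurable_union_def)
  qed (use \<V> * in \<open>auto simp: is_measurable_union_def\<close>)
qed

lemma dissipative_borel: "dissipative_part T \<in> sets borel"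
  using dissipative_part_union by blast

lemma conservative_borel: "conservative_part T \<in> sets borel"
  using dissipative_borel by (auto simp: conservative_part_def)

lemma wandering_subset_dissipative: "wandering T W \<Longrightarrow> W \<subseteq>\<^sub>L dissipative_part T"
  using dissipative_part_union by metis

lemma subset_conservative_iff: "A \<subseteq>\<^sub>L conservative_part T \<longleftrightarrow> negligible (A \<inter> dissipative_part T)"
proof -
  have "A - conservative_part T = A \<inter> dissipative_part T"
    by (auto simp: conservative_part_def)
  then show ?thesis
    by (simp add: subset_mod_null_iff)
qed

text \<open>Preimages of wandering sets are wandering, so the preimage of the dissipative part lies
  in the dissipative part. Only this inclusion holds in general, hence only forward invariance of
  the complement.\<close>

lemma conservative_forward_invariant: "conservative_part T \<subseteq>\<^sub>L T -` conservative_part T"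
proof -
  obtain \<V> where \<V>: "countable \<V>" "\<And>W. W \<in> \<V> \<Longrightarrow> wandering T W" "dissipative_part T \<subseteq>\<^sub>L \<Union>\<V>"
    using dissipative_part_union by metis
  have "T -` dissipative_part T \<subseteq>\<^sub>L T -` \<Union>\<V>"
    using vimage_funpow_mono[OF \<V>(3), of 1] by simp
  also have "T -` \<Union>\<V> = (\<Union>W\<in>\<V>. T -` W)"
    by auto
  also have "\<dots> \<subseteq>\<^sub>L dissipative_part T"
    using \<V> by (intro subset_mod_null_UN wandering_subset_dissipative wandering_vimage_T)
  finally show ?thesis
    unfolding subset_mod_null_iff
    by (rule negligible_subset) (auto simp: conservative_part_def)
qed

text \<open>Halmos' recurrence theorem. At its last visit the orbit is at a point of
  \<open>A\<close> that never returns. Such points form a wandering subset of the conservative part,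
  hence a null set, and so do its countably many preimages.\<close>

lemma negligible_finitely_recurrent:
  assumes A: "A \<in> sets borel" "A \<subseteq>\<^sub>L conservative_part T"
  shows "negligible {x \<in> A. finite {n. (T ^^ n) x \<in> A}}"
proof -
  \<comment> \<open>the points that never return; they form a wandering set\<close>
  define W where "W = A - (\<Union>n\<in>{1..}. (T ^^ n) -` A)"
  have W: "(T ^^ i) -` W \<inter> (T ^^ j) -` W = {}" if "i < j" for i j
  proof (intro equals0I)
    fix x assume x: "x \<in> (T ^^ i) -` W \<inter> (T ^^ j) -` W"
    have "(T ^^ (j - i)) ((T ^^ i) x) = (T ^^ j) x"
      using that by (simp flip: funpow_add[THEN fun_cong, unfolded o_apply])
    then have "(T ^^ i) x \<in> (T ^^ (j - i)) -` A"
      using x by (simp add: W_def)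
    moreover have "j - i \<in> {1..}"
      using that by simp
    ultimately show False
      using x unfolding W_def by blast
  qed
  have "W \<in> sets borel"
    unfolding W_def using A(1) by (intro sets.Diff sets.countable_UN' vimage_funpow_borel) auto
  then have "wandering T W"
    using W unfolding wandering_def eq_mod_null_empty_iff by (metis Int_commute negligible_empty nat_neq_iff)
  then have "W \<subseteq>\<^sub>L dissipative_part T"
    by (rule wandering_subset_dissipative)
  moreover have "W \<subseteq>\<^sub>L conservative_part T"
    using A(2) unfolding subset_mod_null_iff by (rule negligible_subset) (auto simp: W_def)
  ultimately have "negligible ((W - dissipative_part T) \<union> (W - conservative_part T))"
    by (auto simp: subset_mod_null_iff)
  then have "negligible W"
    by (rule negligible_subset) (auto simp: conservative_part_def)
  then have "negligible (\<Union>n. (T ^^ n) -` W)"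
    by (intro negligible_countable_Union) (auto intro: negligible_vimage_funpow)
  then show ?thesis
  proof (rule negligible_subset, intro subsetI)
    fix x assume x: "x \<in> {x \<in> A. finite {n. (T ^^ n) x \<in> A}}"
    define N where "N = Max {n. (T ^^ n) x \<in> A}"
    have ne: "{n. (T ^^ n) x \<in> A} \<noteq> {}"
      using x by (auto intro!: exI[of _ 0])
    then have "N \<in> {n. (T ^^ n) x \<in> A}"
      unfolding N_def using x by (intro Max_in) auto
    moreover have "(T ^^ m) ((T ^^ N) x) \<notin> A" if "m \<ge> 1" for m
    proof
      assume "(T ^^ m) ((T ^^ N) x) \<in> A"
      then have "(T ^^ (m + N)) x \<in> A"
        by (simp add: funpow_add)
      then have "m + N \<le> N"
        unfolding N_def using x by (intro Max_ge) auto
      with that show False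
        by simp
    qed
    ultimately show "x \<in> (\<Union>n. (T ^^ n) -` W)"
      by (auto simp: W_def)
  qed
qed

section \<open>Forward invariant conservative sets fill intervals\<close>

text \<open>By forward invariance, a point whose \<open>n\<close>-th image lies in
  \<open>I_l - A\<close> is itself outside \<open>A\<close> up to a null set, and
  \<open>measure_cyl_vimage\<close> bounds the measure of these points from below. The factor
  \<open>c\<close> depends on \<open>l\<close> and \<open>A\<close> but not on
  \<open>n\<close>.\<close>

lemma cyl_deficit:
  assumes x: "x \<in> generic" and l: "idx ((T ^^ n) x) = l"
    and A: "A \<in> sets borel" "A \<subseteq>\<^sub>L T -` A"
  defines "c \<equiv> 1 - measure lebesgue (markov_interval a l - A)
    / (distortion\<^sup>2 * measure lebesgue (markov_interval a l))"
  shows "measure lebesgue (cyl n x \<inter> A) \<le> c * measure lebesgue (cyl n x)"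
proof -
  define B where "B = markov_interval a l - A"
  let ?C = "cyl n x" and ?X = "cyl n x \<inter> (T ^^ n) -` B" and ?I = "markov_interval a l"
  have B: "B \<in> sets borel" "B \<inter> ?I = B"
    using A(1) by (auto simp: B_def)
  have C: "?C \<in> lmeasurable"
    using cyl_subset[of n x] by (intro interval_subset_lmeasurable borel_imp_lebesgue cyl_borel)
  have X: "?X \<in> lmeasurable"
    using cyl_subset[of n x] B
    by (intro interval_subset_lmeasurable[of _ "idx x"] borel_imp_lebesgue sets.Int cyl_borel vimage_funpow_borel) auto
  have "?C \<inter> A \<subseteq>\<^sub>L ?C - ?X"
    using forward_invariant_funpow[OF A(2), of n] unfolding subset_mod_null_iff
    by (rule negligible_subset) (auto simp: B_def)
  then have "measure lebesgue (?C \<inter> A) \<le> measure lebesgue (?C - ?X)"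
    using A C X by (intro measure_mono_mod_null) (auto intro: borel_imp_lebesgue)
  also have "\<dots> = measure lebesgue ?C - measure lebesgue ?X"
    using C X by (intro measurable_measure_Diff) (auto dest: fmeasurableD)
  also have "\<dots> \<le> c * measure lebesgue ?C"
  proof -
    have "measure lebesgue B * measure lebesgue ?C \<le> distortion\<^sup>2 * measure lebesgue ?X * measure lebesgue ?I"
      using measure_cyl_vimage[OF x B(1) l[symmetric]] B(2) by simp
    moreover have "distortion\<^sup>2 * measure lebesgue ?I > 0"
      using distortion_ge_1 measure_markov_interval_pos[of l] by simp
    ultimately have "measure lebesgue B * measure lebesgue ?C / (distortion\<^sup>2 * measure lebesgue ?I) \<le> measure lebesgue ?X"
      by (simp add: pos_divide_le_eq mult_ac)
    then show ?thesis
      by (simp add: c_def B_def left_diff_distrib)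
  qed
  finally show ?thesis .
qed

text \<open>A covering lemma in the manner of stopping times: every point takes its cylinder of the
  least rank satisfying \<open>P\<close>. Disjointness holds because cylinders are nested or
  disjoint and \<open>P\<close> sees only data shared by all points of a cylinder.\<close>

lemma disjoint_first_cylinders:
  assumes R: "R \<subseteq> generic" and ex: "\<And>x. x \<in> R \<Longrightarrow> \<exists>n. P (cyl n x) (idx ((T ^^ n) x))"
  obtains \<F> where "countable \<F>" "disjoint_family_on (\<lambda>C. C) \<F>" "R \<subseteq> \<Union>\<F>"
    "\<And>C. C \<in> \<F> \<Longrightarrow> \<exists>n x. x \<in> generic \<and> C = cyl n x \<and> P C (idx ((T ^^ n) x))"
proof -
  define N where "N x = (LEAST n. P (cyl n x) (idx ((T ^^ n) x)))" for x
  have N: "P (cyl (N x) x) (idx ((T ^^ N x) x))" if "x \<in> R" for x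
    unfolding N_def using ex[OF that] by (rule LeastI_ex)
  \<comment> \<open>If two chosen cylinders meet, the one of smaller rank is also a cylinder around
    \<open>y\<close> satisfying \<open>P\<close>, so minimality of \<open>N y\<close> makes the
    ranks equal.\<close>
  have eq: "cyl (N x) x = cyl (N y) y"
    if xy: "x \<in> R" "y \<in> R" "z \<in> cyl (N x) x" "z \<in> cyl (N y) y" "N x \<le> N y" for x y z
  proof -
    have *: "cyl (N x) x = cyl (N x) y"
      using cyl_eq[OF xy(3), of "N x"] cyl_eq[OF xy(4) xy(5)] by simp
    have "idx ((T ^^ N x) x) = idx ((T ^^ N x) y)"
      using cyl_idx[OF xy(3), of "N x"] cyl_idx[OF xy(4) xy(5)] by simp
    then have "P (cyl (N x) y) (idx ((T ^^ N x) y))"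
      using N[OF xy(1)] * by simp
    then have "N y \<le> N x"
      unfolding N_def[of y] by (rule Least_le)
    with xy(5) * show ?thesis
      by simp
  qed
  show thesis
  proof (rule that[of "(\<lambda>x. cyl (N x) x) ` R"])
    show "countable ((\<lambda>x. cyl (N x) x) ` R)"
      by (rule countable_subset[OF _ countable_cylinders]) auto
    show "disjoint_family_on (\<lambda>C. C) ((\<lambda>x. cyl (N x) x) ` R)"
      unfolding disjoint_family_on_def
    proof (intro ballI impI)
      fix C C' assume C: "C \<in> (\<lambda>x. cyl (N x) x) ` R" "C' \<in> (\<lambda>x. cyl (N x) x) ` R" "C \<noteq> C'"
      then obtain x y where xy: "x \<in> R" "y \<in> R" "C = cyl (N x) x" "C' = cyl (N y) y"
        by blast
      with C(3) eq[of x y] eq[of y x] show "C \<inter> C' = {}"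
        by (cases "N x \<le> N y") auto
    qed
    show "R \<subseteq> \<Union>((\<lambda>x. cyl (N x) x) ` R)"
      using R cyl_self by auto
    show "\<exists>n x. x \<in> generic \<and> C = cyl n x \<and> P C (idx ((T ^^ n) x))"
      if "C \<in> (\<lambda>x. cyl (N x) x) ` R" for C
      using that N R by auto
  qed
qed

text \<open>With only forward invariance assumed, the result applies both to invariant sets and to
  the conservative part itself.\<close>

lemma conservative_fills_interval:
  assumes A: "A \<in> sets borel" "A \<subseteq>\<^sub>L T -` A" "A \<subseteq>\<^sub>L conservative_part T"
    and pos: "\<not> negligible (A \<inter> markov_interval a j)"
  shows "markov_interval a j \<subseteq>\<^sub>L A"
proof (rule ccontr)
  let ?I = "markov_interval a j"
  assume not: "\<not> ?I \<subseteq>\<^sub>L A"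
  define c where "c = 1 - measure lebesgue (?I - A) / (distortion\<^sup>2 * measure lebesgue ?I)"
  have IA: "?I - A \<in> lmeasurable" "A \<inter> ?I \<in> lmeasurable" "?I \<in> lmeasurable"
    using A(1) by (auto intro!: interval_subset_lmeasurable[of _ j] borel_imp_lebesgue)
  have "measure lebesgue (?I - A) > 0"
    using not IA(1) by (simp add: subset_mod_null_iff negligible_iff_measure0 zero_less_measure_iff)
  moreover have I: "distortion\<^sup>2 \<ge> 1" "measure lebesgue ?I > 0"
    using distortion_ge_1 measure_markov_interval_pos[of j] by (auto simp: one_le_power)
  moreover have "distortion\<^sup>2 * measure lebesgue ?I > 0"
    using I by (intro mult_pos_pos) auto
  ultimately have c1: "c < 1"
    by (simp add: c_def)
  \<comment> \<open>Nonnegativity of \<open>c\<close> is what later permits replacing the union of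
    the cylinders by the larger set \<open>U\<close>.\<close>
  have "measure lebesgue (?I - A) \<le> measure lebesgue ?I"
    using IA by (intro measure_mono_fmeasurable) auto
  also have "\<dots> \<le> distortion\<^sup>2 * measure lebesgue ?I"
    using mult_right_mono[OF I(1), of "measure lebesgue ?I"] I by simp
  finally have c0: "c \<ge> 0"
    using I distortion_ge_1 by (simp add: c_def divide_le_eq_1)
  define N where "N = {x \<in> A \<inter> ?I. finite {n. (T ^^ n) x \<in> A \<inter> ?I}}"
  define R where "R = (A \<inter> ?I \<inter> generic) - N"
  have N: "negligible N"
    unfolding N_def
  proof (rule negligible_finitely_recurrent)
    show "A \<inter> ?I \<subseteq>\<^sub>L conservative_part T"
      using A(3) unfolding subset_mod_null_iff by (rule negligible_subset) auto
  qed (use A(1) in auto)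
  have "negligible (N \<union> (- generic))"
    using N negligible_not_generic by auto
  then have AR: "A \<inter> ?I \<subseteq>\<^sub>L R"
    unfolding subset_mod_null_iff by (rule negligible_subset) (auto simp: R_def)
  have R: "R \<in> lmeasurable"
  proof (rule interval_subset_lmeasurable)
    have "A \<inter> ?I \<inter> generic \<in> sets lebesgue"
      using A(1) by (intro borel_imp_lebesgue) auto
    then show "R \<in> sets lebesgue"
      unfolding R_def using negligible_imp_sets[OF N] by (rule sets.Diff)
  qed (auto simp: R_def)
  have "measure lebesgue (A \<inter> ?I) > 0"
    using pos IA(2) by (simp add: negligible_iff_measure0 zero_less_measure_iff)
  also have "measure lebesgue (A \<inter> ?I) \<le> measure lebesgue R"
    using AR IA(2) R by (intro measure_mono_mod_null) auto
  finally have mR: "measure lebesgue R > 0" .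
  \<comment> \<open>chosen so that \<open>c * (measure R + e) < measure R\<close>\<close>
  define e where "e = (1 - c) * measure lebesgue R"
  have "e > 0"
    using c1 mR by (simp add: e_def)
  \<comment> \<open>Outer regularity: a cover of \<open>R\<close> by cylinders inside
    \<open>U\<close> exceeds \<open>R\<close> by less than \<open>e\<close>, too little for the
    proportion \<open>1 - c\<close> that every one of them misses.\<close>
  then obtain U where U: "open U" "R \<subseteq> U" "U - R \<in> lmeasurable" "emeasure lebesgue (U - R) < ennreal e"
    using sets_lebesgue_outer_open[of R e] R by (auto dest: fmeasurableD)
  have mUR: "measure lebesgue (U - R) < e"
    using U(3,4) by (simp add: emeasure_eq_measure2 ennreal_less_iff)
  have "U = R \<union> (U - R)"
    using U(2) by auto
  then have U': "U \<in> lmeasurable" "measure lebesgue U = measure lebesgue R + measure lebesgue (U - R)"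
    using R U(3) by (metis fmeasurable.Un, metis Diff_disjoint disjnt_def measure_Un2 Diff_idemp)
  \<comment> \<open>Recurrence supplies arbitrarily late returns to \<open>I_j\<close>, and
    cylinders of sufficiently late rank lie inside \<open>U\<close>.\<close>
  have "\<exists>n. cyl n x \<subseteq> U \<and> idx ((T ^^ n) x) = j" if x: "x \<in> R" for x
  proof -
    have g: "x \<in> generic" and inf: "infinite {n. (T ^^ n) x \<in> A \<inter> ?I}"
      using x by (auto simp: R_def N_def)
    obtain M where M: "\<And>n. n \<ge> M \<Longrightarrow> cyl n x \<subseteq> U"
      using ex_cyl_subset_open[OF g U(1)] x U(2) by blast
    obtain n where "n \<ge> M" "(T ^^ n) x \<in> A \<inter> ?I"
      using inf by (auto simp: infinite_nat_iff_unbounded_le)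
    with M generic_mem_interval_iff[OF generic_funpow[OF g]] show ?thesis
      by blast
  qed
  then obtain \<F> where \<F>: "countable \<F>" "disjoint_family_on (\<lambda>C. C) \<F>" "R \<subseteq> \<Union>\<F>"
    "\<And>C. C \<in> \<F> \<Longrightarrow> \<exists>n x. x \<in> generic \<and> C = cyl n x \<and> C \<subseteq> U \<and> idx ((T ^^ n) x) = j"
    using disjoint_first_cylinders[of R "\<lambda>C l. C \<subseteq> U \<and> l = j"] unfolding R_def by (metis IntD2 DiffD1 subsetI)
  have borel: "C \<in> sets borel" "C \<in> lmeasurable" "C \<inter> A \<in> lmeasurable" if C: "C \<in> \<F>" for C
  proof -
    obtain n x where nx: "C = cyl n x"
      using \<F>(4)[OF C] by blast
    then show "C \<in> sets borel"
      by (simp add: cyl_borel)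
    with nx cyl_subset[of n x] A(1) show "C \<in> lmeasurable" "C \<inter> A \<in> lmeasurable"
      by (auto intro!: interval_subset_lmeasurable[of _ "idx x"] borel_imp_lebesgue)
  qed
  have UF: "\<Union>\<F> \<subseteq> U" "\<Union>\<F> \<in> sets borel"
    using \<F>(1,4) borel by (blast, intro sets.countable_Union) auto
  then have UF': "\<Union>\<F> \<in> lmeasurable"
    using U'(1) by (metis borel_imp_lebesgue fmeasurableI2)
  have "measure lebesgue R \<le> measure lebesgue (\<Union>C\<in>\<F>. C \<inter> A)"
  proof (rule measure_mono_fmeasurable)
    show "(\<Union>C\<in>\<F>. C \<inter> A) \<in> lmeasurable"
      using A(1) UF UF' fmeasurable_Int_fmeasurable[OF UF' borel_imp_lebesgue[OF A(1)]] by simp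
  qed (use \<F>(3) R in \<open>auto simp: R_def\<close>)
  also have "\<dots> \<le> c * measure lebesgue (\<Union>C\<in>\<F>. C)"
  proof (rule measure_UN_le_mult)
    show "disjoint_family_on (\<lambda>C. C \<inter> A) \<F>"
      using \<F>(2) by (auto simp: disjoint_family_on_def)
    show "measure lebesgue (C \<inter> A) \<le> c * measure lebesgue C" if "C \<in> \<F>" for C
      using \<F>(4)[OF that] cyl_deficit A unfolding c_def by blast
  qed (use \<F> borel c0 UF' in auto)
  also have "\<dots> \<le> c * measure lebesgue U"
    using UF UF' U' c0 by (intro mult_left_mono measure_mono_fmeasurable) (auto dest: fmeasurableD)
  also have "\<dots> \<le> c * (measure lebesgue R + e)"
    using U' mUR c0 by (intro mult_left_mono) auto
  also have "\<dots> = measure lebesgue R - (1 - c)\<^sup>2 * measure lebesgue R"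
    by (simp add: e_def power2_eq_square algebra_simps)
  also have "\<dots> < measure lebesgue R"
    using c1 mR by simp
  finally show False
    by simp
qed

section \<open>Communicating classes\<close>

text \<open>Reduces covering modulo null sets to pure combinatorics: one witness orbit of generic
  points already yields a path in \<open>edge\<close>, and a path yields preimages for all generic
  points.\<close>

lemma covers_iff: "markov_interval a k \<subseteq>\<^sub>L (T ^^ n) ` markov_interval a j \<longleftrightarrow> (j, k) \<in> edge ^^ n"
proof
  assume jk: "(j, k) \<in> edge ^^ n"
  show "markov_interval a k \<subseteq>\<^sub>L (T ^^ n) ` markov_interval a j"
  proof (rule subset_mod_null_genericI)
    fix z assume "z \<in> generic" "z \<in> markov_interval a k"
    then obtain w where "idx w = j" "(T ^^ n) w = z"
      using generic_preimage_funpow[of z j n] jk generic_mem_interval_iff by auto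
    then show "z \<in> (T ^^ n) ` markov_interval a j"
      using mem_markov_interval_idx by blast
  qed
next
  assume sub: "markov_interval a k \<subseteq>\<^sub>L (T ^^ n) ` markov_interval a j"
  \<comment> \<open>Discarding the image of the nongeneric points, which is null, ensures that the
    preimage found below is itself generic.\<close>
  let ?N = "(T ^^ n) ` (- generic) \<union> (- generic) \<union> (markov_interval a k - (T ^^ n) ` markov_interval a j)"
  have "negligible ?N"
    using sub negligible_not_generic by (auto intro: negligible_image_funpow simp: subset_mod_null_iff)
  then have "\<not> markov_interval a k \<subseteq> ?N"
    using not_negligible_markov_interval negligible_subset by blast
  then obtain x where "x \<in> generic" "x \<in> markov_interval a j" "(T ^^ n) x \<in> generic" "(T ^^ n) x \<in> markov_interval a k"
    by auto
  then show "(j, k) \<in> edge ^^ n"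
    using funpow_idx_edge[of x n] generic_mem_interval_iff by auto
qed

lemma feeds_iff: "feeds a T j k \<longleftrightarrow> (j, k) \<in> edge\<^sup>+"
  by (auto simp: feeds_def covers_iff trancl_power Suc_le_eq)

lemma feedsI: "(j, k) \<in> edge ^^ n \<Longrightarrow> n \<ge> 1 \<Longrightarrow> feeds a T j k"
  by (auto simp: feeds_def covers_iff)

lemma feeds_trans: "feeds a T i j \<Longrightarrow> feeds a T j k \<Longrightarrow> feeds a T i k"
  by (auto simp: feeds_iff)

lemma forward_invariant_feeds:
  assumes "A \<subseteq>\<^sub>L T -` A" "markov_interval a j \<subseteq>\<^sub>L A" "feeds a T j k"
  shows "markov_interval a k \<subseteq>\<^sub>L A"
  using assms(3) image_forward_invariant[OF assms(1,2)] subset_mod_null_trans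
  unfolding feeds_def by blast

text \<open>Along a path in \<open>edge\<close>, \<open>T ^^ n\<close> maps this part of
  \<open>I_j\<close> onto all generic points of \<open>B\<close> in \<open>I_k\<close>, and the
  image of a null set would be null.\<close>

lemma not_negligible_preimage:
  assumes "(j, k) \<in> edge ^^ n" "\<not> negligible (B \<inter> markov_interval a k)"
  shows "\<not> negligible (markov_interval a j \<inter> (T ^^ n) -` (B \<inter> markov_interval a k))"
proof
  assume "negligible (markov_interval a j \<inter> (T ^^ n) -` (B \<inter> markov_interval a k))"
  then have "negligible ((T ^^ n) ` (markov_interval a j \<inter> (T ^^ n) -` (B \<inter> markov_interval a k)) \<union> (- generic))"
    using negligible_not_generic by (auto intro: negligible_image_funpow)
  then have "negligible (B \<inter> markov_interval a k)"
  proof (rule negligible_subset, intro subsetI)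
    fix z assume z: "z \<in> B \<inter> markov_interval a k"
    show "z \<in> (T ^^ n) ` (markov_interval a j \<inter> (T ^^ n) -` (B \<inter> markov_interval a k)) \<union> (- generic)"
    proof (cases "z \<in> generic")
      case True
      then obtain w where "idx w = j" "(T ^^ n) w = z"
        using generic_preimage_funpow[of z j n] assms(1) z generic_mem_interval_iff by auto
      then show ?thesis
        using z mem_markov_interval_idx[of w] by auto
    qed auto
  qed
  with assms(2) show False
    by simp
qed

text \<open>A set of positive measure in \<open>I_j\<close> passes through \<open>I_k\<close> at
  time \<open>n\<close>. By recurrence almost all of its points return to \<open>I_j\<close> after
  that, and one such generic orbit is a path back.\<close>

lemma conservative_feeds_back:
  assumes C: "markov_interval a j \<subseteq>\<^sub>L conservative_part T" and jk: "feeds a T j k"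
  shows "feeds a T k j"
proof -
  obtain n where n: "n \<ge> 1" "(j, k) \<in> edge ^^ n"
    using jk by (auto simp: feeds_def covers_iff)
  let ?P = "markov_interval a j \<inter> (T ^^ n) -` (UNIV \<inter> markov_interval a k)"
  let ?N = "{x \<in> markov_interval a j. finite {n. (T ^^ n) x \<in> markov_interval a j}} \<union> (- generic)"
  have "negligible ?N"
    using negligible_finitely_recurrent[OF markov_interval_borel C] negligible_not_generic by auto
  moreover have "\<not> negligible ?P"
    using not_negligible_preimage[OF n(2), of UNIV] not_negligible_markov_interval by simp
  ultimately have "\<not> ?P \<subseteq> ?N"
    using negligible_subset by blast
  then obtain x where x: "x \<in> generic" "(T ^^ n) x \<in> markov_interval a k"
    "infinite {n. (T ^^ n) x \<in> markov_interval a j}"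
    by auto
  obtain m where m: "m \<ge> Suc n" "(T ^^ m) x \<in> markov_interval a j"
    using x(3) unfolding infinite_nat_iff_unbounded_le by blast
  have "(T ^^ (m - n)) ((T ^^ n) x) = (T ^^ m) x"
    using m(1) by (simp flip: funpow_add[THEN fun_cong, unfolded o_apply])
  then have "(k, j) \<in> edge ^^ (m - n)"
    using funpow_idx_edge[OF generic_funpow[OF x(1)], of n "m - n"] m x generic_funpow
      generic_mem_interval_iff by metis
  then show ?thesis
    using m(1) by (intro feedsI) auto
qed

lemma equiv_communicate: "equiv UNIV {(j, k). communicate a T j k}"
proof (rule equivI)
  show "trans {(j, k). communicate a T j k}"
    by (rule transI) (auto simp: communicate_def intro: feeds_trans)
qed (auto simp: communicate_def refl_on_def sym_def)

text \<open>Essentiality turns accessibility from inside into communication, and isolation forbids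
  accessibility from outside, so the class is closed under \<open>feeds\<close> in both
  directions.\<close>

lemma isolated_class:
  assumes "Z \<in> isolated_classes a T"
  shows "Z \<noteq> {}"
    and "j \<in> Z \<Longrightarrow> k \<in> Z \<Longrightarrow> communicate a T j k"
    and "j \<in> Z \<Longrightarrow> feeds a T j k \<Longrightarrow> k \<in> Z"
    and "k \<in> Z \<Longrightarrow> feeds a T j k \<Longrightarrow> j \<in> Z"
proof -
  have Z: "Z \<in> UNIV // {(j, k). communicate a T j k}"
    using assms by (simp add: isolated_classes_def comm_classes_def)
  show "Z \<noteq> {}"
    using Z in_quotient_imp_non_empty[OF equiv_communicate] by blast
  show comm: "communicate a T j k" if "j \<in> Z" "k \<in> Z" for j k
    using in_quotient_imp_in_rel[OF equiv_communicate Z, of j k] that by simp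
  show "k \<in> Z" if "j \<in> Z" "feeds a T j k"
  proof -
    have "feeds a T k j"
      using assms that by (auto simp: isolated_classes_def inessential_def)
    then show ?thesis
      using in_quotient_imp_closed[OF equiv_communicate Z that(1), of k] that(2)
      by (simp add: communicate_def)
  qed
  show "j \<in> Z" if "k \<in> Z" "feeds a T j k"
    using assms that by (auto simp: isolated_classes_def)
qed

lemma class_union_borel [measurable]: "class_union a Z \<in> sets borel"
  unfolding class_union_def by (intro sets.countable_UN') auto

lemma generic_mem_class_union_iff: "x \<in> generic \<Longrightarrow> x \<in> class_union a Z \<longleftrightarrow> idx x \<in> Z"
  by (auto simp: class_union_def generic_mem_interval_iff)

lemma interval_subset_class_union_iff: "markov_interval a j \<subseteq>\<^sub>L class_union a Z \<longleftrightarrow> j \<in> Z"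
proof
  assume "markov_interval a j \<subseteq>\<^sub>L class_union a Z"
  then have "negligible ((markov_interval a j - class_union a Z) \<union> (- generic))"
    using negligible_not_generic by (auto simp: subset_mod_null_iff)
  then have "\<not> markov_interval a j \<subseteq> (markov_interval a j - class_union a Z) \<union> (- generic)"
    using not_negligible_markov_interval negligible_subset by blast
  then show "j \<in> Z"
    using generic_mem_interval_iff generic_mem_class_union_iff by auto
next
  assume "j \<in> Z"
  then show "markov_interval a j \<subseteq>\<^sub>L class_union a Z"
    by (intro subset_imp_subset_mod_null) (auto simp: class_union_def)
qed

lemma class_union_subset_iff:
  "class_union a Z \<subseteq>\<^sub>L A \<longleftrightarrow> (\<forall>j\<in>Z. markov_interval a j \<subseteq>\<^sub>L A)"
proof
  assume "class_union a Z \<subseteq>\<^sub>L A"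
  then show "\<forall>j\<in>Z. markov_interval a j \<subseteq>\<^sub>L A"
    using subset_mod_null_trans interval_subset_class_union_iff by blast
next
  assume "\<forall>j\<in>Z. markov_interval a j \<subseteq>\<^sub>L A"
  then show "class_union a Z \<subseteq>\<^sub>L A"
    unfolding class_union_def by (intro subset_mod_null_UN) auto
qed

lemma not_negligible_ex_interval:
  assumes "\<not> negligible A"
  obtains j where "\<not> negligible (A \<inter> markov_interval a j)"
proof -
  have "A = (\<Union>j. A \<inter> markov_interval a j)"
    using mem_markov_interval_idx by auto
  then have "\<exists>j. \<not> negligible (A \<inter> markov_interval a j)"
    using assms negligible_countable_Union[of "range (\<lambda>j. A \<inter> markov_interval a j)"] by auto
  then show thesis
    using that by blast
qed

lemma T_invariant_forward:
  assumes "T_invariant T A"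
  shows "A \<subseteq>\<^sub>L T -` A" "- A \<subseteq>\<^sub>L T -` (- A)"
proof -
  have "A \<subseteq>\<^sub>L T -` A" "T -` A \<subseteq>\<^sub>L A"
    using assms by (auto simp: T_invariant_def eq_mod_null_iff)
  then show "A \<subseteq>\<^sub>L T -` A" "- A \<subseteq>\<^sub>L T -` (- A)"
    by (auto simp: subset_mod_null_def)
qed

text \<open>Each step of a generic orbit follows an edge, and no edge enters or leaves an isolated
  class.\<close>

lemma isolated_class_invariant:
  assumes "Z \<in> isolated_classes a T"
  shows "T_invariant T (class_union a Z)"
proof -
  have "x \<in> T -` class_union a Z \<longleftrightarrow> x \<in> class_union a Z" if "x \<in> generic" for x
  proof -
    have "feeds a T (idx x) (idx (T x))"
      using generic_edge[OF that] by (intro feedsI[of _ _ 1]) auto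
    then have "idx (T x) \<in> Z \<longleftrightarrow> idx x \<in> Z"
      using isolated_class(3,4)[OF assms] by blast
    moreover have "T x \<in> generic"
      using that by (blast dest: generic_T_iff[THEN iffD1])
    ultimately show ?thesis
      using that by (simp add: generic_mem_class_union_iff)
  qed
  then show ?thesis
    unfolding T_invariant_def eq_mod_null_iff
    by (auto intro!: subset_mod_null_genericI)
qed

lemma isolated_class_fill:
  assumes Z: "Z \<in> isolated_classes a T" and A: "A \<subseteq>\<^sub>L T -` A" "j \<in> Z" "markov_interval a j \<subseteq>\<^sub>L A"
  shows "class_union a Z \<subseteq>\<^sub>L A"
  unfolding class_union_subset_iff
proof
  fix k assume "k \<in> Z"
  then have "j = k \<or> feeds a T j k"
    using isolated_class(2)[OF Z A(2)] by (auto simp: communicate_def)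
  then show "markov_interval a k \<subseteq>\<^sub>L A"
    using forward_invariant_feeds[OF A(1,3)] A(3) by blast
qed

lemma isolated_class_ergodic:
  assumes Z: "Z \<in> isolated_classes a T" and C: "class_union a Z \<subseteq>\<^sub>L conservative_part T"
  shows "ergodic_component T (class_union a Z)"
  unfolding ergodic_component_def
proof (intro conjI allI impI)
  obtain j where "j \<in> Z"
    using isolated_class(1)[OF Z] by blast
  then have "\<not> negligible (class_union a Z)"
    using not_negligible_markov_interval[of j] negligible_subset[of "class_union a Z"]
    by (auto simp: class_union_def)
  then show "emeasure lborel (class_union a Z) > 0"
    using negligible_iff_emeasure0[of "class_union a Z"] class_union_borel[of Z]
    by (simp add: borel_imp_lebesgue zero_less_iff_neq_zero)
next
  fix B assume B: "T_invariant T B" "B \<subseteq>\<^sub>L class_union a Z"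
  show "B =\<^sub>L {} \<or> B =\<^sub>L class_union a Z"
  proof (cases "negligible B")
    case False
    then obtain j where "\<not> negligible (B \<inter> markov_interval a j)"
      using not_negligible_ex_interval by blast
    then have j: "markov_interval a j \<subseteq>\<^sub>L B"
      using B T_invariant_forward[OF B(1)] subset_mod_null_trans[OF B(2) C]
      by (intro conservative_fills_interval) (auto simp: T_invariant_def)
    then have "j \<in> Z"
      using subset_mod_null_trans[OF _ B(2)] interval_subset_class_union_iff by blast
    then show ?thesis
      using isolated_class_fill[OF Z T_invariant_forward(1)[OF B(1)]] j B(2) by (simp add: eq_mod_null_iff)
  qed (simp add: eq_mod_null_empty_iff)
qed (rule isolated_class_invariant[OF Z])

lemma isolated_class_dichotomy:
  assumes Z: "Z \<in> isolated_classes a T" and pos: "\<not> negligible (class_union a Z \<inter> conservative_part T)"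
  shows "class_union a Z \<subseteq>\<^sub>L conservative_part T"
proof -
  obtain j where j: "\<not> negligible (class_union a Z \<inter> conservative_part T \<inter> markov_interval a j)"
    using pos not_negligible_ex_interval by blast
  then have "\<not> class_union a Z \<inter> conservative_part T \<inter> markov_interval a j \<subseteq> - generic"
    using negligible_not_generic negligible_subset by blast
  then have "j \<in> Z"
    using generic_mem_interval_iff generic_mem_class_union_iff by auto
  moreover have "\<not> negligible (conservative_part T \<inter> markov_interval a j)"
    using j by (metis inf_assoc inf_le2 negligible_subset)
  then have "markov_interval a j \<subseteq>\<^sub>L conservative_part T"
    by (intro conservative_fills_interval conservative_borel conservative_forward_invariant)
       (simp add: subset_imp_subset_mod_null)
  ultimately show ?thesis
    using isolated_class_fill[OF Z conservative_forward_invariant] by blast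
qed

text \<open>Both the class union and its complement are forward invariant, so images and preimages
  of the conservative part, which misses the class union, never reach it. Hence the hull of the
  conservative part misses it as well.\<close>

lemma isolated_class_subset_hull_D:
  assumes Z: "Z \<in> isolated_classes a T" and null: "negligible (class_union a Z \<inter> conservative_part T)"
  shows "class_union a Z \<subseteq>\<^sub>L hull_D T"
proof -
  let ?M = "class_union a Z"
  note inv = T_invariant_forward[OF isolated_class_invariant[OF Z]]
  have "conservative_part T \<subseteq>\<^sub>L - ?M"
    using null by (simp add: subset_mod_null_iff Int_commute)
  then have img: "(T ^^ n) ` conservative_part T \<subseteq>\<^sub>L - ?M" for n
    by (rule image_forward_invariant[OF inv(2)])
  have "(T ^^ k) -` (T ^^ n) ` conservative_part T \<subseteq>\<^sub>L - ?M" for k n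
  proof -
    have "(T ^^ k) -` (T ^^ n) ` conservative_part T \<subseteq>\<^sub>L (T ^^ k) -` (- ?M)"
      by (rule vimage_funpow_mono[OF img])
    also have "(T ^^ k) -` (- ?M) \<subseteq>\<^sub>L - ?M"
      using forward_invariant_funpow[OF inv(1), of k] by (auto simp: subset_mod_null_def)
    finally show ?thesis .
  qed
  then have "invariant_hull T (conservative_part T) \<subseteq>\<^sub>L - ?M"
    unfolding invariant_hull_def by (intro subset_mod_null_UN) auto
  then have "negligible ((invariant_hull T (conservative_part T) \<inter> ?M) \<union> (?M \<inter> conservative_part T))"
    using null by (simp add: subset_mod_null_iff)
  \<comment> \<open>The hull takes preimages of order at least 1, hence the witnesses
    \<open>k = n = 1\<close>: a point lies in the preimage of its own image.\<close>
  moreover have "dissipative_part T \<subseteq> invariant_hull T (dissipative_part T)"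
    unfolding invariant_hull_def by (auto intro!: bexI[of _ 1] exI[of _ 1])
  ultimately show ?thesis
    unfolding subset_mod_null_iff hull_D_def hull_CD_def
    by (elim negligible_subset) (auto simp: conservative_part_def)
qed

section \<open>Finite isolated classes are conservative\<close>

text \<open>Sums \<open>measure_cyl_vimage\<close> over the disjoint cylinders of rank
  \<open>n\<close> that start in \<open>Z\<close> and end in \<open>l\<close>: of the points in
  \<open>I_l\<close> at time \<open>n\<close>, a proportion independent of \<open>n\<close> is in
  \<open>B\<close>.\<close>

lemma measure_vimage_class_bound:
  assumes B: "B \<in> sets borel" "B \<subseteq> markov_interval a l" "measure lebesgue B > 0"
    and M: "class_union a Z \<in> lmeasurable"
  shows "measure lebesgue ((T ^^ n) -` markov_interval a l \<inter> class_union a Z \<inter> generic)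
    \<le> distortion\<^sup>2 * measure lebesgue (markov_interval a l) / measure lebesgue B
        * measure lebesgue ((T ^^ n) -` B \<inter> class_union a Z)"
proof -
  let ?c = "distortion\<^sup>2 * measure lebesgue (markov_interval a l) / measure lebesgue B"
  define \<G> where "\<G> = {cyl n x | x. x \<in> generic \<and> idx x \<in> Z \<and> idx ((T ^^ n) x) = l}"
  have eq: "(T ^^ n) -` markov_interval a l \<inter> class_union a Z \<inter> generic = (\<Union>C\<in>\<G>. C)"
  proof (intro equalityI subsetI)
    fix x assume "x \<in> (T ^^ n) -` markov_interval a l \<inter> class_union a Z \<inter> generic"
    then have "x \<in> generic" "idx x \<in> Z" "idx ((T ^^ n) x) = l"
      using generic_mem_class_union_iff generic_mem_interval_iff generic_funpow by auto
    then have "cyl n x \<in> \<G>" "x \<in> cyl n x"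
      using cyl_self by (auto simp: \<G>_def)
    then show "x \<in> (\<Union>C\<in>\<G>. C)"
      by blast
  next
    fix y assume "y \<in> (\<Union>C\<in>\<G>. C)"
    then obtain x where x: "y \<in> cyl n x" "idx x \<in> Z" "idx ((T ^^ n) x) = l"
      by (auto simp: \<G>_def)
    then show "y \<in> (T ^^ n) -` markov_interval a l \<inter> class_union a Z \<inter> generic"
      using cyl_idx[OF x(1), of 0] cyl_idx[OF x(1), of n] cyl_generic[OF x(1)]
        generic_mem_class_union_iff generic_mem_interval_iff generic_funpow
      by auto
  qed
  have c: "?c \<ge> 0"
    by simp
  have disj: "disjoint_family_on (\<lambda>C. C) \<G>"
    unfolding disjoint_family_on_def
  proof (intro ballI impI)
    fix C C' assume C: "C \<in> \<G>" "C' \<in> \<G>" "C \<noteq> C'"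
    then obtain x y where "C = cyl n x" "C' = cyl n y"
      by (auto simp: \<G>_def)
    with C(3) show "C \<inter> C' = {}"
      using cyl_eq[of _ n _ n] by (metis disjoint_iff order_refl)
  qed
  have sub: "(\<Union>C\<in>\<G>. C \<inter> (T ^^ n) -` B) \<subseteq> (T ^^ n) -` B \<inter> class_union a Z"
    using eq by blast
  have countable: "countable \<G>"
    by (rule countable_subset[OF _ countable_cylinders]) (auto simp: \<G>_def)
  have vB: "(T ^^ n) -` B \<in> sets lebesgue"
    using B(1) by (intro borel_imp_lebesgue vimage_funpow_borel)
  have meas: "C \<in> lmeasurable" "C \<inter> (T ^^ n) -` B \<in> lmeasurable" if C: "C \<in> \<G>" for C
  proof -
    obtain x where "C = cyl n x"
      using C by (auto simp: \<G>_def)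
    then show "C \<in> lmeasurable"
      using cyl_subset[of n x] by (auto intro!: interval_subset_lmeasurable borel_imp_lebesgue cyl_borel)
    then show "C \<inter> (T ^^ n) -` B \<in> lmeasurable"
      using vB by (rule fmeasurable_Int_fmeasurable)
  qed
  have "(\<Union>C\<in>\<G>. C \<inter> (T ^^ n) -` B) \<in> sets lebesgue"
    using countable meas by (intro sets.countable_UN') (auto dest: fmeasurableD)
  moreover have M': "(T ^^ n) -` B \<inter> class_union a Z \<in> lmeasurable"
    using fmeasurable_Int_fmeasurable[OF M vB] by (simp add: Int_commute)
  ultimately have fin: "(\<Union>C\<in>\<G>. C \<inter> (T ^^ n) -` B) \<in> lmeasurable"
    using sub by (metis fmeasurableI2)
  have "measure lebesgue (\<Union>C\<in>\<G>. C) \<le> ?c * measure lebesgue (\<Union>C\<in>\<G>. C \<inter> (T ^^ n) -` B)"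
  proof (rule measure_UN_le_mult)
    show "disjoint_family_on (\<lambda>C. C \<inter> (T ^^ n) -` B) \<G>"
      using disj by (auto simp: disjoint_family_on_def)
    show "measure lebesgue C \<le> ?c * measure lebesgue (C \<inter> (T ^^ n) -` B)" if "C \<in> \<G>" for C
    proof -
      obtain x where "x \<in> generic" "C = cyl n x" "l = idx ((T ^^ n) x)"
        using \<open>C \<in> \<G>\<close> by (auto simp: \<G>_def)
      moreover have "B \<inter> markov_interval a l = B"
        using B(2) by auto
      ultimately have "measure lebesgue B * measure lebesgue C
          \<le> distortion\<^sup>2 * measure lebesgue (C \<inter> (T ^^ n) -` B) * measure lebesgue (markov_interval a l)"
        using measure_cyl_vimage[OF _ B(1), of x l n] by simp
      then show ?thesis
        using B(3) by (simp add: pos_le_divide_eq mult_ac)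
    qed
  qed (use countable disj meas c fin in auto)
  also have "\<dots> \<le> ?c * measure lebesgue ((T ^^ n) -` B \<inter> class_union a Z)"
    using fin M' sub c by (intro mult_left_mono measure_mono_fmeasurable) (auto dest: fmeasurableD)
  finally show ?thesis
    unfolding eq .
qed

text \<open>A wandering set may meet only one interval \<open>I_k\<close> of the class, whereas at
  time \<open>n\<close> the mass may sit in any other one, for instance because of periodicity. The
  set is therefore first pulled back to every interval of the class. Finiteness bounds the total
  measure as well as the constants.\<close>

lemma finite_isolated_class_conservative:
  assumes Z: "Z \<in> isolated_classes a T" and fin: "finite Z"
  shows "class_union a Z \<subseteq>\<^sub>L conservative_part T"
proof (rule ccontr)
  let ?M = "class_union a Z"
  assume "\<not> ?M \<subseteq>\<^sub>L conservative_part T"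
  then have D: "\<not> negligible (?M \<inter> dissipative_part T)"
    by (simp add: subset_conservative_iff)
  obtain \<V> where \<V>: "countable \<V>" "\<And>W. W \<in> \<V> \<Longrightarrow> wandering T W" "dissipative_part T \<subseteq>\<^sub>L \<Union>\<V>"
    using dissipative_part_union by metis
  have "\<exists>W\<in>\<V>. \<exists>k\<in>Z. \<not> negligible (W \<inter> markov_interval a k)"
  proof (rule ccontr)
    assume "\<not> ?thesis"
    then have "negligible (\<Union>p\<in>\<V> \<times> Z. fst p \<inter> markov_interval a (snd p))"
      using \<V>(1) by (intro negligible_countable_Union) auto
    then have "negligible ((\<Union>p\<in>\<V> \<times> Z. fst p \<inter> markov_interval a (snd p)) \<union> (dissipative_part T - \<Union>\<V>))"
      using \<V>(3) by (simp add: subset_mod_null_iff)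
    then have "negligible (?M \<inter> dissipative_part T)"
      by (rule negligible_subset) (auto simp: class_union_def)
    with D show False
      by simp
  qed
  then obtain W k where W: "wandering T W" and k: "k \<in> Z" "\<not> negligible (W \<inter> markov_interval a k)"
    using \<V>(2) by blast
  have M: "?M \<in> lmeasurable"
    unfolding class_union_def using fin
    by (intro fmeasurable.finite_UN) (auto intro!: interval_subset_lmeasurable borel_imp_lebesgue)
  have mM: "measure lebesgue ?M > 0"
  proof -
    have "measure lebesgue (markov_interval a k) \<le> measure lebesgue ?M"
      using k(1) M by (intro measure_mono_fmeasurable) (auto simp: class_union_def borel_imp_lebesgue)
    then show ?thesis
      using measure_markov_interval_pos[of k] by simp
  qed
  \<comment> \<open>Length 0 is allowed: communication of \<open>k\<close> with itself does not by
    definition include a cycle.\<close>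
  have "\<exists>q. (l, k) \<in> edge ^^ q" if "l \<in> Z" for l
    using isolated_class(2)[OF Z that k(1)] relpow_0_I unfolding communicate_def feeds_def covers_iff by metis
  then obtain q where q: "\<And>l. l \<in> Z \<Longrightarrow> (l, k) \<in> edge ^^ q l"
    by metis
  define B where "B l = markov_interval a l \<inter> (T ^^ q l) -` (W \<inter> markov_interval a k)" for l
  have B: "B l \<in> sets borel" "B l \<subseteq> markov_interval a l" for l
    using W by (auto simp: B_def wandering_def intro!: sets.Int vimage_funpow_borel)
  have mB: "measure lebesgue (B l) > 0" if "l \<in> Z" for l
  proof -
    have "B l \<in> lmeasurable"
      using B by (intro interval_subset_lmeasurable borel_imp_lebesgue)
    then show ?thesis
      using not_negligible_preimage[OF q[OF that] k(2)]
      by (simp add: B_def negligible_iff_measure0 zero_less_measure_iff)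
  qed
  define X where "X l n = (T ^^ n) -` B l \<inter> ?M" for l n
  have X: "X l n \<in> lmeasurable" for l n
    using fmeasurable_Int_fmeasurable[OF M borel_imp_lebesgue[OF vimage_funpow_borel[OF B(1)]]]
    by (simp add: X_def Int_commute)
  \<comment> \<open>\<open>X l n\<close> lies in the preimage of \<open>W\<close> of order
    \<open>q l + n\<close>. For fixed \<open>l\<close> these orders are distinct, so the sets are
    disjoint up to null sets.\<close>
  have sum_X: "(\<Sum>n<N. measure lebesgue (X l n)) \<le> measure lebesgue ?M" for l N
  proof -
    have "negligible (X l m \<inter> X l n)" if "m \<noteq> n" for m n
    proof (rule negligible_subset)
      show "negligible ((T ^^ (q l + m)) -` W \<inter> (T ^^ (q l + n)) -` W)"
        using W that by (simp add: wandering_def eq_mod_null_empty_iff)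
      show "X l m \<inter> X l n \<subseteq> (T ^^ (q l + m)) -` W \<inter> (T ^^ (q l + n)) -` W"
        by (auto simp: X_def B_def funpow_add)
    qed
    then have "(\<Sum>n<N. measure lebesgue (X l n)) = measure lebesgue (\<Union>n<N. X l n)"
      using X by (intro measure_negligible_finite_Union_image[symmetric]) (auto simp: pairwise_def)
    also have "\<dots> \<le> measure lebesgue ?M"
    proof (rule measure_mono_fmeasurable)
      show "(\<Union>n<N. X l n) \<in> sets lebesgue"
        using X by (intro sets.finite_UN) (auto dest: fmeasurableD)
    qed (use M in \<open>auto simp: X_def\<close>)
    finally show ?thesis .
  qed
  define c where "c l = distortion\<^sup>2 * measure lebesgue (markov_interval a l) / measure lebesgue (B l)" for l
  \<comment> \<open>Any common upper bound of the finitely many nonnegative \<open>c l\<close>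
    serves; their sum is one.\<close>
  define \<kappa> where "\<kappa> = (\<Sum>l\<in>Z. c l)"
  have c: "c l \<ge> 0" "\<kappa> \<ge> 0" for l
    by (auto simp: c_def \<kappa>_def intro!: sum_nonneg)
  have lower: "measure lebesgue ?M \<le> \<kappa> * (\<Sum>l\<in>Z. measure lebesgue (X l n))" for n
  proof -
    let ?Y = "\<lambda>l. (T ^^ n) -` markov_interval a l \<inter> ?M \<inter> generic"
    have Y: "?Y l \<in> sets lebesgue" for l
      by (intro borel_imp_lebesgue sets.Int vimage_funpow_borel) auto
    have "?M \<inter> generic = (\<Union>l\<in>Z. ?Y l)"
    proof (intro equalityI subsetI)
      fix x assume x: "x \<in> ?M \<inter> generic"
      then have "idx x \<in> Z"
        using generic_mem_class_union_iff by auto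
      then have "idx ((T ^^ n) x) \<in> Z"
        using funpow_idx_edge[of x n] feedsI[of "idx x" "idx ((T ^^ n) x)" n] isolated_class(3)[OF Z] x
        by (cases n) auto
      with x show "x \<in> (\<Union>l\<in>Z. ?Y l)"
        using mem_markov_interval_idx by auto
    qed auto
    then have "measure lebesgue ?M = measure lebesgue (\<Union>l\<in>Z. ?Y l)"
      using measure_Int_generic[OF M] by simp
    also have "\<dots> \<le> (\<Sum>l\<in>Z. measure lebesgue (?Y l))"
      using fin Y by (intro measure_UNION_le)
    also have "\<dots> \<le> (\<Sum>l\<in>Z. c l * measure lebesgue (X l n))"
      unfolding c_def X_def using B mB M by (intro sum_mono measure_vimage_class_bound)
    also have "\<dots> \<le> (\<Sum>l\<in>Z. \<kappa> * measure lebesgue (X l n))"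
      using c fin by (intro sum_mono mult_right_mono) (auto simp: \<kappa>_def intro!: member_le_sum)
    finally show ?thesis
      by (simp add: sum_distrib_left)
  qed
  \<comment> \<open>Summed over \<open>n < N\<close>, the lower bound grows linearly in
    \<open>N\<close>, while disjointness keeps the right-hand side bounded.\<close>
  have "real N * measure lebesgue ?M \<le> \<kappa> * (real (card Z) * measure lebesgue ?M)" for N
  proof -
    have "real N * measure lebesgue ?M = (\<Sum>n<N. measure lebesgue ?M)"
      by simp
    also have "\<dots> \<le> (\<Sum>n<N. \<kappa> * (\<Sum>l\<in>Z. measure lebesgue (X l n)))"
      by (intro sum_mono lower)
    also have "\<dots> = \<kappa> * (\<Sum>l\<in>Z. \<Sum>n<N. measure lebesgue (X l n))"
      by (simp add: sum_distrib_left[symmetric] sum.swap[of _ Z])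
    also have "\<dots> \<le> \<kappa> * (\<Sum>l\<in>Z. measure lebesgue ?M)"
      using c by (intro mult_left_mono sum_mono sum_X)
    finally show ?thesis
      by simp
  qed
  then have "real N \<le> \<kappa> * real (card Z)" for N
    using mM by (metis mult.assoc mult_le_cancel_right_pos)
  then show False
    using reals_Archimedean2 by (metis not_le)
qed

section \<open>Periods and conservative ergodic components\<close>

text \<open>A cycle of length \<open>n\<close> at \<open>k\<close> can be inserted into a cycle at
  \<open>j\<close> of length \<open>p + q\<close> through \<open>k\<close>. The period of
  \<open>j\<close> divides both \<open>p + q\<close> and \<open>p + n + q\<close>, hence
  \<open>n\<close>.\<close>

lemma period_communicate:
  assumes "communicate a T j k"
  shows "period a T j = period a T k"
proof -
  have dvd: "period a T j dvd period a T k" if jk: "communicate a T j k" "j \<noteq> k" for j k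
  proof -
    obtain p q where pq: "p \<ge> 1" "(j, k) \<in> edge ^^ p" "(k, j) \<in> edge ^^ q"
      using jk by (auto simp: communicate_def feeds_def covers_iff)
    have loop: "period a T j dvd n" if "n \<ge> 1" "(j, j) \<in> edge ^^ n" for n
      unfolding period_def covers_iff using that by (intro Gcd_dvd) auto
    have "period a T j dvd n" if "(k, k) \<in> edge ^^ n" for n
    proof -
      have "(j, j) \<in> edge ^^ (p + q)" "(j, j) \<in> edge ^^ (p + n + q)"
        using pq that by (auto simp: relpow_add)
      then have "period a T j dvd p + q" "period a T j dvd p + q + n"
        using pq(1) loop[of "p + q"] loop[of "p + n + q"] by (auto simp: ac_simps)
      then show ?thesis
        by (metis dvd_add_right_iff)
    qed
    then show ?thesis
      unfolding period_def[of a T k] covers_iff by (intro Gcd_greatest) auto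
  qed
  show ?thesis
    using dvd[of j k] dvd[of k j] assms
    by (cases "j = k") (auto intro: dvd_antisym simp: communicate_def)
qed

lemma class_period_eq:
  assumes "Z \<in> isolated_classes a T" "j \<in> Z"
  shows "class_period a T Z = period a T j"
  unfolding class_period_def
proof (rule the_equality)
  show "\<forall>k\<in>Z. period a T k = period a T j"
    using isolated_class(2)[OF assms(1) _ assms(2)] by (intro ballI period_communicate)
  show "p = period a T j" if "\<forall>k\<in>Z. period a T k = p" for p
    using that assms(2) by simp
qed

text \<open>The intervals contained in \<open>E\<close> are closed under successors and
  predecessors, and conservativity makes accessibility between them symmetric. So any one of them
  generates an isolated class, whose union is an invariant subset of \<open>E\<close> of positive
  measure and thus all of \<open>E\<close>.\<close>

lemma conservative_ergodic_component_class:
  assumes E: "ergodic_component T E" and C: "E \<subseteq>\<^sub>L conservative_part T"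
  shows "\<exists>Z \<in> isolated_classes a T. E =\<^sub>L class_union a Z"
proof -
  have inv: "T_invariant T E" and borel: "E \<in> sets borel"
    using E by (auto simp: ergodic_component_def T_invariant_def)
  note forward = T_invariant_forward[OF inv]
  have "emeasure lebesgue E \<noteq> 0"
    using E borel by (auto simp: ergodic_component_def)
  then have "\<not> negligible E"
    using negligible_iff_emeasure0[OF borel_imp_lebesgue[OF borel]] by simp
  then obtain j where "\<not> negligible (E \<inter> markov_interval a j)"
    using not_negligible_ex_interval by blast
  define S where "S = {j. markov_interval a j \<subseteq>\<^sub>L E}"
  have fills: "i \<in> S" if "\<not> negligible (E \<inter> markov_interval a i)" for i
    using conservative_fills_interval[OF borel forward(1) C that] by (simp add: S_def)
  have succ: "k \<in> S" if "i \<in> S" "feeds a T i k" for i k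
    using that forward_invariant_feeds[OF forward(1)] by (auto simp: S_def)
  have feeds_back: "feeds a T k i" if "i \<in> S" "feeds a T i k" for i k
  proof -
    have "markov_interval a i \<subseteq>\<^sub>L conservative_part T"
      using that(1) subset_mod_null_trans[OF _ C] by (simp add: S_def)
    then show ?thesis
      using that(2) by (rule conservative_feeds_back)
  qed
  \<comment> \<open>Uses invariance of the complement: an interval is in \<open>E\<close> or misses
    \<open>E\<close> up to null sets, and one that misses \<open>E\<close> can feed only intervals
    that miss \<open>E\<close>.\<close>
  have pred: "i \<in> S" if "k \<in> S" "feeds a T i k" for i k
  proof (rule ccontr)
    assume "i \<notin> S"
    then have "negligible (E \<inter> markov_interval a i)"
      using fills by blast
    then have "markov_interval a i \<subseteq>\<^sub>L - E"
      by (simp add: subset_mod_null_iff Int_commute)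
    then have "markov_interval a k \<subseteq>\<^sub>L - E"
      using forward_invariant_feeds[OF forward(2)] that(2) by blast
    then have "negligible ((markov_interval a k - (- E)) \<union> (markov_interval a k - E))"
      using that(1) by (auto simp: S_def subset_mod_null_iff)
    then have "negligible (markov_interval a k)"
      by (rule negligible_subset) auto
    then show False
      using not_negligible_markov_interval by blast
  qed
  have j: "j \<in> S"
    by (rule fills) fact
  define Z where "Z = {k. communicate a T j k}"
  have ZS: "Z \<subseteq> S"
    using j succ by (auto simp: Z_def communicate_def)
  have iso: "Z \<in> isolated_classes a T"
    unfolding isolated_classes_def mem_Collect_eq
  proof (intro conjI ballI allI impI)
    show "Z \<in> comm_classes a T"
      by (auto simp: Z_def comm_classes_def quotient_def)
    show "\<not> inessential a T i" if "i \<in> Z" for i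
      using ZS that feeds_back by (auto simp: inessential_def)
    show "\<not> feeds a T i k" if "i \<notin> Z" "k \<in> Z" for i k
    proof
      assume ik: "feeds a T i k"
      then have "feeds a T k i"
        using ZS that(2) pred feeds_back by blast
      then have "communicate a T k i"
        using ik by (simp add: communicate_def)
      then have "i \<in> Z"
        using that(2) by (auto simp: Z_def communicate_def intro: feeds_trans)
      with that(1) show False
        by simp
    qed
  qed
  have sub: "class_union a Z \<subseteq>\<^sub>L E"
    using ZS by (auto simp: class_union_subset_iff S_def)
  have "\<not> negligible (class_union a Z)"
    using isolated_class_ergodic[OF iso subset_mod_null_trans[OF sub C]]
      negligible_iff_emeasure0[OF borel_imp_lebesgue[OF class_union_borel]]
    by (auto simp: ergodic_component_def)
  then have "class_union a Z =\<^sub>L E"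
    using E isolated_class_invariant[OF iso] sub by (auto simp: ergodic_component_def eq_mod_null_empty_iff)
  then show ?thesis
    using iso by (auto simp: eq_mod_null_iff)
qed

end

theorem proposition2p5:
  fixes a :: "int \<Rightarrow> real"
    and T :: "real \<Rightarrow> real"
    and \<tau> \<tau>' \<tau>'' :: "int \<Rightarrow> real \<Rightarrow> real"
    and k1 k2 :: "int \<Rightarrow> int"
    and \<theta> \<Lambda> \<eta> :: real
  assumes "surjective_markov_map a T \<tau> \<tau>' \<tau>'' k1 k2 \<theta> \<Lambda> \<eta>"
  shows "(\<forall>E. ergodic_component T E \<and> E \<subseteq>\<^sub>L conservative_part T \<longrightarrow>
            (\<exists>Z \<in> isolated_classes a T. E =\<^sub>L class_union a Z \<and>
               (\<forall>j. markov_interval a j \<subseteq>\<^sub>L E \<longrightarrow> period a T j = class_period a T Z)))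
       \<and> (\<forall>Z \<in> isolated_classes a T. finite Z \<longrightarrow>
            ergodic_component T (class_union a Z) \<and> class_union a Z \<subseteq>\<^sub>L conservative_part T)
       \<and> (\<forall>Z \<in> isolated_classes a T. infinite Z \<longrightarrow>
            (ergodic_component T (class_union a Z) \<and> class_union a Z \<subseteq>\<^sub>L conservative_part T)
          \<or> (T_invariant T (class_union a Z) \<and> class_union a Z \<subseteq>\<^sub>L hull_D T))"
proof -
  interpret surjective_markov_map a T \<tau> \<tau>' \<tau>'' k1 k2 \<theta> \<Lambda> \<eta>
    by (rule assms)
  have "\<exists>Z \<in> isolated_classes a T. E =\<^sub>L class_union a Z \<and>
      (\<forall>j. markov_interval a j \<subseteq>\<^sub>L E \<longrightarrow> period a T j = class_period a T Z)"
    if "ergodic_component T E" "E \<subseteq>\<^sub>L conservative_part T" for E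
  proof -
    obtain Z where Z: "Z \<in> isolated_classes a T" "E =\<^sub>L class_union a Z"
      using conservative_ergodic_component_class[OF \<open>ergodic_component T E\<close> \<open>E \<subseteq>\<^sub>L conservative_part T\<close>] by blast
    have "period a T j = class_period a T Z" if "markov_interval a j \<subseteq>\<^sub>L E" for j
    proof -
      have "markov_interval a j \<subseteq>\<^sub>L class_union a Z"
        using that Z(2) subset_mod_null_trans by (auto simp: eq_mod_null_iff)
      then show ?thesis
        using class_period_eq[OF Z(1)] interval_subset_class_union_iff by simp
    qed
    with Z show ?thesis
      by blast
  qed
  \<comment> \<open>For an infinite class the alternative is decided by whether its union meets the
    conservative part in positive measure.\<close>
  then show ?thesis
    using finite_isolated_class_conservative isolated_class_ergodic isolated_class_dichotomy
      isolated_class_invariant isolated_class_subset_hull_D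
    by meson
qed

end
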